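(* A dual Banach space admits a dual almost square (ASQ) norm if and only if it contains an isomorphic copy of $c_0$. That is, for every Banach space $Y$, there is an equivalent norm on $Y^*$ which is a dual norm and for which $Y^*$ is ASQ if and only if $Y^*$ contains a closed subspace isomorphic to $c_0$.
   Context: A Banach space $X$ with unit sphere $S_X$ is almost square (ASQ) if for every $\varepsilon > 0$ and every finite set $(x_i)_{i=1}^n \subset S_X$ there exists $h \in S_X$ such that $\|x_i + h\| \le 1 + \varepsilon$ and $\|x_i - h\| \le 1+\varepsilon$ for every $i = 1, \dots, n$. An equivalent norm on $Y^*$ is a dual norm if it is the dual norm of some equivalent norm on $Y$. Isomorphic means linearly homeomorphic. *)

theory Defs
  imports "HOL-Analysis.Analysis"
begin

definition is_norm :: "('a::real_vector \<Rightarrow> real) \<Rightarrow> bool" where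
  "is_norm N \<longleftrightarrow>
     (\<forall>x. N x = 0 \<longleftrightarrow> x = 0) \<and>
     (\<forall>x y. N (x + y) \<le> N x + N y) \<and>
     (\<forall>r x. N (r *\<^sub>R x) = \<bar>r\<bar> * N x)"

definition equivalent_norm :: "('a::real_normed_vector \<Rightarrow> real) \<Rightarrow> bool" where
  "equivalent_norm N \<longleftrightarrow>
     is_norm N \<and> (\<exists>a>0. \<exists>b>0. \<forall>x. a * norm x \<le> N x \<and> N x \<le> b * norm x)"

text \<open>
  The supremum is a genuine one whenever \<open>p\<close> is an equivalent norm: the set is then nonempty
  and bounded above.
\<close>

definition dual_norm_of ::
    "('a::real_normed_vector \<Rightarrow> real) \<Rightarrow> ('a \<Rightarrow>\<^sub>L real) \<Rightarrow> real" where
  "dual_norm_of p f = (SUP x\<in>{x. p x \<le> 1}. \<bar>blinfun_apply f x\<bar>)"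

definition is_dual_norm :: "(('a::real_normed_vector \<Rightarrow>\<^sub>L real) \<Rightarrow> real) \<Rightarrow> bool" where
  "is_dual_norm N \<longleftrightarrow> (\<exists>p. equivalent_norm p \<and> N = dual_norm_of p)"

text \<open>
  The empty family is allowed, so an almost square space has a nonempty unit sphere; in particular
  the zero space is not almost square.
\<close>

definition almost_square :: "('a::real_vector \<Rightarrow> real) \<Rightarrow> bool" where
  "almost_square N \<longleftrightarrow>
     (\<forall>\<epsilon>>0. \<forall>A. finite A \<and> A \<subseteq> {x. N x = 1} \<longrightarrow>
        (\<exists>h. N h = 1 \<and> (\<forall>x\<in>A. N (x + h) \<le> 1 + \<epsilon> \<and> N (x - h) \<le> 1 + \<epsilon>)))"

text \<open>
  As \<open>nat\<close> is discrete, \<open>nat \<Rightarrow>\<^sub>C real\<close> is the space of all bounded real sequences with the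
  supremum norm, and the null sequences form a closed subspace of it.
\<close>

definition c0 :: "(nat \<Rightarrow>\<^sub>C real) set" where
  "c0 = {x. apply_bcontfun x \<longlonglongrightarrow> 0}"

text \<open>Linearity is only required on \<open>S\<close>, which is meant to be a linear subspace.\<close>

definition linearly_homeomorphic ::
    "'a::real_normed_vector set \<Rightarrow> 'b::real_normed_vector set \<Rightarrow> bool" where
  "linearly_homeomorphic S T \<longleftrightarrow>
     (\<exists>f g. homeomorphism S T f g \<and>
        (\<forall>x\<in>S. \<forall>y\<in>S. f (x + y) = f x + f y) \<and>
        (\<forall>r. \<forall>x\<in>S. f (r *\<^sub>R x) = r *\<^sub>R f x))"

definition contains_copy_of_c0 :: "'a::real_normed_vector itself \<Rightarrow> bool" where
  "contains_copy_of_c0 _ \<longleftrightarrow>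
     (\<exists>S :: 'a set. subspace S \<and> closed S \<and> linearly_homeomorphic c0 S)"

end

theory Submission
  imports Defs "HOL-Library.Nat_Bijection"
begin

text \<open>
  Suppose first that \<open>N\<close> is almost square. Applying the definition to the finitely many signed sums
  of the vectors found so far yields \<open>h\<^sub>0, h\<^sub>1, \<dots>\<close> of norm one all of whose signed partial sums have
  norm at most \<open>3/2\<close> (\<open>almost_square_sign_sequence\<close>). By convexity the same bound holds for
  coefficients in \<open>[-1, 1]\<close>, and since this bound is below \<open>2\<close>, flipping the sign of a largest
  coefficient gives a matching lower bound. So the \<open>h\<^sub>n\<close> are equivalent to the unit vectors of \<open>c\<^sub>0\<close>.

  Conversely, a copy of \<open>c\<^sub>0\<close> in \<open>Y\<^sup>*\<close> gives functionals \<open>f\<^sub>n\<close> with \<open>\<Sum>\<bar>f\<^sub>n x\<bar> \<le> C \<parallel>x\<parallel>\<close> and, after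
  passing to a subsequence and to differences of norming vectors, bounded \<open>y\<^sub>n\<close> in \<open>Y\<close> which are
  biorthogonal to the \<open>f\<^sub>n\<close> up to quickly vanishing errors
  (\<open>contains_copy_of_c0_imp_almost_biorthogonal\<close>). Morally \<open>Y = \<ell>\<^sub>1 \<oplus> Z\<close>, where the \<open>y\<^sub>n\<close> are the
  unit vectors of \<open>\<ell>\<^sub>1\<close> and \<open>Q = \<Sum> f\<^sub>n \<otimes> y\<^sub>n\<close> (\<open>quasi_proj\<close>) is the
  projection onto \<open>\<ell>\<^sub>1\<close>. The coordinates
  \<open>c\<^sub>n = g(y\<^sub>n)\<close> of a functional \<open>g\<close> are arranged in blocks: for each level \<open>j\<close> there are infinitely
  many blocks, and the points of a block of level \<open>j\<close> are the \<open>2\<^sup>j\<close> subsets \<open>A\<close> of \<open>{0, \<dots>, j - 1}\<close>. With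
  \<open>r\<^sub>i(A) = \<plusminus>1\<close> according to \<open>i \<in> A\<close>, the new norm \<open>N(g)\<close> is the supremum of

    \<^item> \<open>\<bar>c\<^sub>n\<bar> / 2\<close> for all \<open>n\<close>;
    \<^item> the averages of \<open>\<bar>c\<^sub>n\<bar>\<close> over \<open>j\<close> points taken from \<open>j\<close> different blocks of level \<open>j\<close>;
    \<^item> the Rademacher coefficients \<open>\<bar>2\<^sup>-\<^sup>j \<Sum>\<^sub>A r\<^sub>i(A) c\<^sub>A\<bar>\<close>, \<open>i < j\<close>, of the blocks of level \<open>j\<close>;
    \<^item> the norm of \<open>g \<circ> (1 - Q)\<close>.

  Given finitely many \<open>g\<close> in the unit ball, choose \<open>j\<close> large. The averages force \<open>\<bar>c\<^sub>n\<bar> \<le> 1\<close> on all but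
  finitely many blocks of level \<open>j\<close>, so some block, as far out as desired, is good for all \<open>g\<close>. By
  Bessel's inequality a single \<open>g\<close> can correlate noticeably only with boundedly many of the \<open>j\<close>
  Rademacher functions of that block, so some \<open>r\<^sub>i\<close> is almost uncorrelated with all \<open>g\<close>. Then
  \<open>h = \<Sum>\<^sub>A r\<^sub>i(A) f\<^sub>A\<close> works, up to small errors: its \<open>i\<close>-th Rademacher coefficient is about one; adding \<open>\<plusminus>h\<close> raises the
  coordinates in the block to about two at most, which the factor \<open>1/2\<close> tolerates; it changes only one of
  the \<open>j\<close> points in each average; it changes only one Rademacher coefficient, which was small; and
  it almost vanishes on the range of \<open>1 - Q\<close>.

  All these quantities are values of \<open>g\<close> at vectors of \<open>Y\<close>. Hence \<open>N\<close> is the supremum over a bounded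
  convex symmetric set with interior, and such a supremum is dual to the Minkowski functional of the
  set.
\<close>

section \<open>Almost square norms produce copies of \<open>c\<^sub>0\<close>\<close>

lemma is_norm_zero: "is_norm N \<Longrightarrow> N 0 = 0"
  and is_norm_triangle: "is_norm N \<Longrightarrow> N (x + y) \<le> N x + N y"
  and is_norm_scale: "is_norm N \<Longrightarrow> N (r *\<^sub>R x) = \<bar>r\<bar> * N x"
  by (auto simp: is_norm_def)

lemma is_norm_minus: "is_norm N \<Longrightarrow> N (- x) = N x"
  using is_norm_scale[of N "-1" x] by simp

lemma is_norm_nonneg: "is_norm N \<Longrightarrow> 0 \<le> N x"
  using is_norm_triangle[of N x "- x"] is_norm_minus[of N x] is_norm_zero[of N] by simp

lemma is_norm_convex:
  assumes "is_norm N" "N x \<le> C" "N y \<le> C" "0 \<le> t" "t \<le> 1"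
  shows "N ((1 - t) *\<^sub>R x + t *\<^sub>R y) \<le> C"
proof -
  have "N ((1 - t) *\<^sub>R x + t *\<^sub>R y) \<le> (1 - t) * N x + t * N y"
    using is_norm_triangle[OF assms(1), of "(1 - t) *\<^sub>R x" "t *\<^sub>R y"] assms
    by (simp add: is_norm_scale)
  also have "\<dots> \<le> (1 - t) * C + t * C"
    using assms by (intro add_mono mult_left_mono) auto
  finally show ?thesis by (simp add: algebra_simps)
qed

text \<open>
  A cube is the convex hull of its vertices; the induction replaces one sign at a time by an
  arbitrary coefficient, which is why the offset \<open>v\<close> is needed.
\<close>
lemma sign_sums_bound_imp_cube_sums_bound:
  assumes N: "is_norm N"
    and "\<And>s :: nat \<Rightarrow> real. (\<forall>i. s i \<in> {-1, 1}) \<Longrightarrow> N (v + (\<Sum>i<n. s i *\<^sub>R h i)) \<le> C"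
    and a: "\<And>i. \<bar>a i\<bar> \<le> 1"
  shows "N (v + (\<Sum>i<n. a i *\<^sub>R h i)) \<le> C"
  using assms(2)
proof (induction n arbitrary: v)
  case 0
  show ?case using 0[of "\<lambda>_. 1"] by simp
next
  case (Suc n)
  let ?w = "v + (\<Sum>i<n. a i *\<^sub>R h i)"
  have *: "N (?w + e *\<^sub>R h n) \<le> C" if e: "e \<in> {-1, 1}" for e
  proof -
    have "N ((v + e *\<^sub>R h n) + (\<Sum>i<n. a i *\<^sub>R h i)) \<le> C"
    proof (rule Suc.IH)
      fix s :: "nat \<Rightarrow> real"
      assume "\<forall>i. s i \<in> {-1, 1}"
      then have "N (v + (\<Sum>i<Suc n. (s(n := e)) i *\<^sub>R h i)) \<le> C"
        using e by (intro Suc.prems) auto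
      then show "N ((v + e *\<^sub>R h n) + (\<Sum>i<n. s i *\<^sub>R h i)) \<le> C"
        by (simp add: algebra_simps)
    qed
    then show ?thesis by (simp add: algebra_simps)
  qed
  have "N ((1 - (1 + a n) / 2) *\<^sub>R (?w + (-1) *\<^sub>R h n) + ((1 + a n) / 2) *\<^sub>R (?w + 1 *\<^sub>R h n)) \<le> C"
    using a[of n] by (intro is_norm_convex[OF N] *) (auto simp: abs_le_iff)
  also have "(1 - (1 + a n) / 2) *\<^sub>R (?w + (-1) *\<^sub>R h n) + ((1 + a n) / 2) *\<^sub>R (?w + 1 *\<^sub>R h n)
      = ?w + a n *\<^sub>R h n"
  proof -
    have "(1 - (1 + a n) / 2) *\<^sub>R (?w + (-1) *\<^sub>R h n) + ((1 + a n) / 2) *\<^sub>R (?w + 1 *\<^sub>R h n)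
      = ((1 - (1 + a n) / 2) + (1 + a n) / 2) *\<^sub>R ?w + ((1 + a n) / 2 - (1 - (1 + a n) / 2)) *\<^sub>R h n"
      by (simp only: scaleR_add_right scaleR_add_left scaleR_diff_left) simp
    also have "\<dots> = 1 *\<^sub>R ?w + a n *\<^sub>R h n"
      by (intro arg_cong2[where f = "\<lambda>p q. p *\<^sub>R ?w + q *\<^sub>R h n"]) (auto simp: field_simps)
    finally show ?thesis by simp
  qed
  finally show ?case by (simp add: algebra_simps)
qed

text \<open>
  Almost squareness speaks only about unit vectors. A vector \<open>x\<close> outside the ball is moved to the
  sphere by subtracting a multiple of \<open>x / N x\<close>, and a vector inside the ball is treated by convexity.
\<close>
lemma almost_square_nonunit:
  assumes N: "is_norm N" and sq: "almost_square N" and "0 < \<epsilon>" "finite A"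
  shows "\<exists>h. N h = 1 \<and> (\<forall>x\<in>A. N (x + h) \<le> max 1 (N x) + \<epsilon> \<and> N (x - h) \<le> max 1 (N x) + \<epsilon>)"
proof -
  let ?A = "(\<lambda>x. (1 / N x) *\<^sub>R x) ` (A - {0})"
  have "?A \<subseteq> {x. N x = 1}"
    using N is_norm_nonneg[OF N] by (auto simp: is_norm_scale) (auto simp: is_norm_def)
  moreover have "finite ?A" using assms by auto
  ultimately have A: "finite ?A \<and> ?A \<subseteq> {x. N x = 1}" by (intro conjI)
  have "\<exists>h. N h = 1 \<and> (\<forall>u\<in>?A. N (u + h) \<le> 1 + \<epsilon> \<and> N (u - h) \<le> 1 + \<epsilon>)"
    by (rule sq[unfolded almost_square_def, rule_format, OF assms(3) A])
  then obtain h where h: "N h = 1"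
      "\<And>u. u \<in> ?A \<Longrightarrow> N (u + h) \<le> 1 + \<epsilon> \<and> N (u - h) \<le> 1 + \<epsilon>"
    by blast
  have key: "N (x + g) \<le> max 1 (N x) + \<epsilon>"
    if x: "x \<in> A" and g: "g = h \<or> g = - h" for x g
  proof (cases "x = 0")
    case True
    then show ?thesis using h(1) g is_norm_minus[OF N, of h] assms(3) by auto
  next
    case False
    let ?t = "N x"
    define u where "u = (1 / N x) *\<^sub>R x"
    have t: "?t > 0" using False N is_norm_nonneg[OF N, of x] by (auto simp: is_norm_def less_le)
    have u: "N (u + g) \<le> 1 + \<epsilon>" using h(2)[of u] x False g by (auto simp: u_def)
    have Nu: "N u = 1" using t by (simp add: u_def is_norm_scale[OF N])
    have xu: "x = ?t *\<^sub>R u" using t by (simp add: u_def)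
    have Ng: "N g = 1" using h(1) g is_norm_minus[OF N, of h] by auto
    show ?thesis
    proof (cases "?t \<ge> 1")
      case True
      have eq: "x + g = (?t - 1) *\<^sub>R u + (u + g)"
        using arg_cong[OF xu, of "\<lambda>z. z + g"] by (simp add: algebra_simps)
      then have "N (x + g) \<le> N ((?t - 1) *\<^sub>R u) + N (u + g)"
        by (subst eq) (rule is_norm_triangle[OF N])
      then show ?thesis using True u Nu is_norm_scale[OF N, of "?t - 1" u] by auto
    next
      case False
      have eq: "x + g = ?t *\<^sub>R (u + g) + (1 - ?t) *\<^sub>R g"
        using arg_cong[OF xu, of "\<lambda>z. z + g"] by (simp add: algebra_simps)
      then have "N (x + g) \<le> N (?t *\<^sub>R (u + g)) + N ((1 - ?t) *\<^sub>R g)"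
        by (subst eq) (rule is_norm_triangle[OF N])
      also have "\<dots> = ?t * N (u + g) + (1 - ?t)"
        using False t Ng by (simp add: is_norm_scale[OF N] del: scaleR_add_right)
      also have "\<dots> \<le> ?t * (1 + \<epsilon>) + (1 - ?t)"
        using u t by (intro add_right_mono mult_left_mono) auto
      also have "\<dots> \<le> 1 + \<epsilon>" using False assms(3) t
        by (simp add: algebra_simps)
      finally show ?thesis by simp
    qed
  qed
  have "N (x + h) \<le> max 1 (N x) + \<epsilon> \<and> N (x - h) \<le> max 1 (N x) + \<epsilon>" if "x \<in> A" for x
    using key[OF that, of h] key[OF that, of "- h"] by simp
  then show ?thesis using h(1) by blast
qed

text \<open>
  Each new vector is chosen for the finite set of all signed sums of its predecessors. The error
  spent at step \<open>n\<close> is \<open>(1/2)\<^bsup>n+2\<^esup>\<close>, so that the bounds \<open>3/2 - (1/2)\<^bsup>n+1\<^esup>\<close> increase from \<open>1\<close> and stay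
  below \<open>3/2\<close>.
\<close>
lemma almost_square_sign_sequence:
  fixes N :: "'b::real_vector \<Rightarrow> real"
  assumes N: "is_norm N" and sq: "almost_square N"
  shows "\<exists>h :: nat \<Rightarrow> 'b. (\<forall>n. N (h n) = 1) \<and>
    (\<forall>n s. (\<forall>i. s i \<in> {-1, 1 :: real}) \<longrightarrow> N (\<Sum>i<n. s i *\<^sub>R h i) \<le> 3 / 2)"
proof -
  define P where "P h n r \<longleftrightarrow> N r = 1 \<and>
      (\<forall>s. (\<forall>i. s i \<in> {-1, 1 :: real}) \<longrightarrow>
        N ((\<Sum>i<n. s i *\<^sub>R h i) + s n *\<^sub>R r) \<le> 3 / 2 - (1 / 2) ^ (n + 2))"
    for h :: "nat \<Rightarrow> 'b" and n r
  have "\<exists>h. \<forall>n. P h n (h n)"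
  proof (rule dependent_wellorder_choice)
    show "P f x r = P g x r" if "\<And>y. y < x \<Longrightarrow> f y = g y" for r f g x
      using that by (simp add: P_def cong: sum.cong_simp)
    fix n h assume IH: "\<And>m. m < n \<Longrightarrow> P h m (h m)"
    let ?A = "(\<lambda>s. \<Sum>i<n. s i *\<^sub>R h i) ` (\<Pi>\<^sub>E i\<in>{..<n}. {-1, 1 :: real})"
    have fin: "finite ?A" by (intro finite_imageI finite_PiE) auto
    obtain r where r: "N r = 1" "\<And>x. x \<in> ?A \<Longrightarrow>
        N (x + r) \<le> max 1 (N x) + (1 / 2) ^ (n + 2) \<and> N (x - r) \<le> max 1 (N x) + (1 / 2) ^ (n + 2)"
      using almost_square_nonunit[OF N sq _ fin, of "(1 / 2) ^ (n + 2)"] by auto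
    have "N ((\<Sum>i<n. s i *\<^sub>R h i) + s n *\<^sub>R r) \<le> 3 / 2 - (1 / 2) ^ (n + 2)"
      if s: "\<forall>i. s i \<in> {-1, 1 :: real}" for s
    proof -
      let ?x = "\<Sum>i<n. s i *\<^sub>R h i"
      have "?x = (\<Sum>i<n. (restrict s {..<n}) i *\<^sub>R h i)"
        by (intro sum.cong) auto
      moreover have "restrict s {..<n} \<in> (\<Pi>\<^sub>E i\<in>{..<n}. {-1, 1 :: real})"
        using s by auto
      ultimately have "?x \<in> ?A" by blast
      note rx = r(2)[OF this]
      have "s n = 1 \<or> s n = -1" using s by auto
      then have 1: "N (?x + s n *\<^sub>R r) \<le> max 1 (N ?x) + (1 / 2) ^ (n + 2)"
      proof
        assume "s n = 1"
        then show ?thesis using rx by (simp only: scaleR_one)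
      next
        assume "s n = -1"
        then show ?thesis using rx by (simp only: scaleR_minus1_left add_uminus_conv_diff)
      qed
      have "N ?x \<le> 3 / 2 - (1 / 2) ^ (n + 1)"
      proof (cases n)
        case 0
        then show ?thesis by (simp add: is_norm_zero[OF N])
      next
        case (Suc m)
        then show ?thesis using IH[of m] s unfolding P_def by auto
      qed
      moreover have "(1 / 2 :: real) ^ (n + 1) \<le> 1 / 2"
        using power_decreasing[of 1 "n + 1" "1 / 2 :: real"] by simp
      ultimately have "max 1 (N ?x) \<le> 3 / 2 - (1 / 2) ^ (n + 1)" by simp
      moreover have "(1 / 2 :: real) ^ (n + 1) = 2 * (1 / 2) ^ (n + 2)" by simp
      ultimately show ?thesis using 1 by linarith
    qed
    then show "\<exists>r. P h n r" using r(1) by (auto simp: P_def)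
  qed
  then obtain h where h: "\<And>n. P h n (h n)" by blast
  have "N (\<Sum>i<n. s i *\<^sub>R h i) \<le> 3 / 2" if s: "\<forall>i. s i \<in> {-1, 1 :: real}" for n s
  proof (cases n)
    case 0
    then show ?thesis by (simp add: is_norm_zero[OF N])
  next
    case (Suc m)
    have "N (\<Sum>i<n. s i *\<^sub>R h i) \<le> 3 / 2 - (1 / 2) ^ (m + 2)"
      using h[of m] s Suc unfolding P_def by simp
    also have "\<dots> \<le> 3 / 2" by simp
    finally show ?thesis .
  qed
  moreover have "N (h n) = 1" for n using h[of n] unfolding P_def by blast
  ultimately show ?thesis by (intro exI[of _ h]) blast
qed

text \<open>
  An upper bound below \<open>2\<close> on the cube is also a lower bound: the vector and the one with the sign of
  its largest coefficient flipped differ by a vector of norm twice that coefficient, and the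
  upper bound on the second leaves at least the rest of this norm for the first.
\<close>
lemma cube_sums_bound_imp_lower_bound:
  fixes h :: "nat \<Rightarrow> 'b::real_vector"
  assumes N: "is_norm N" and h: "\<And>n. N (h n) = 1"
    and up: "\<And>n a. (\<And>i. \<bar>a i\<bar> \<le> 1) \<Longrightarrow> N (\<Sum>i<n. a i *\<^sub>R h i) \<le> C"
    and "C \<le> 2" "k < n"
  shows "(2 - C) * \<bar>a k\<bar> \<le> N (\<Sum>i<n. a i *\<^sub>R h i)"
proof -
  define M where "M = Max ((\<lambda>i. \<bar>a i\<bar>) ` {..<n})"
  have "M \<in> (\<lambda>i. \<bar>a i\<bar>) ` {..<n}" unfolding M_def using \<open>k < n\<close> by (intro Max_in) auto
  then obtain l where l: "l < n" "M = \<bar>a l\<bar>" by auto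
  have le: "\<bar>a i\<bar> \<le> M" if "i < n" for i unfolding M_def using that by (intro Max_ge) auto
  have up': "N (\<Sum>i<n. b i *\<^sub>R h i) \<le> M * C" if b: "\<And>i. i < n \<Longrightarrow> \<bar>b i\<bar> \<le> M" for b
  proof (cases "M = 0")
    case True
    then have "(\<Sum>i<n. b i *\<^sub>R h i) = 0" using b by (intro sum.neutral) auto
    then show ?thesis using True by (simp add: is_norm_zero[OF N])
  next
    case False
    then have M: "M > 0" using l by auto
    have "N (\<Sum>i<n. (if i < n then b i / M else 0) *\<^sub>R h i) \<le> C"
      using b M by (intro up) auto
    moreover have "(\<Sum>i<n. b i *\<^sub>R h i) = M *\<^sub>R (\<Sum>i<n. (if i < n then b i / M else 0) *\<^sub>R h i)"
      using M by (auto simp: scaleR_sum_right intro!: sum.cong)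
    ultimately show ?thesis using M by (simp add: is_norm_scale[OF N])
  qed
  let ?b = "a(l := - a l)"
  have "(\<Sum>i<n. a i *\<^sub>R h i) + (- (\<Sum>i<n. ?b i *\<^sub>R h i)) = (\<Sum>i<n. (a i - ?b i) *\<^sub>R h i)"
    by (simp add: sum_subtractf algebra_simps)
  also have "\<dots> = (\<Sum>i\<in>{..<n}. if i = l then (2 * a l) *\<^sub>R h l else 0)"
    by (intro sum.cong) auto
  also have "\<dots> = (2 * a l) *\<^sub>R h l" using l by simp
  finally have "2 * M \<le> N (\<Sum>i<n. a i *\<^sub>R h i) + N (- (\<Sum>i<n. ?b i *\<^sub>R h i))"
    using is_norm_triangle[OF N, of "\<Sum>i<n. a i *\<^sub>R h i" "- (\<Sum>i<n. ?b i *\<^sub>R h i)"] h l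
    by (simp add: is_norm_scale[OF N])
  moreover have "N (- (\<Sum>i<n. ?b i *\<^sub>R h i)) \<le> M * C"
    unfolding is_norm_minus[OF N] by (intro up') (use le l in auto)
  ultimately have "(2 - C) * M \<le> N (\<Sum>i<n. a i *\<^sub>R h i)" by (simp add: algebra_simps)
  moreover have "(2 - C) * \<bar>a k\<bar> \<le> (2 - C) * M"
    using le[OF \<open>k < n\<close>] \<open>C \<le> 2\<close> by (intro mult_left_mono) auto
  ultimately show ?thesis by simp
qed

lemma c0_iff: "u \<in> c0 \<longleftrightarrow> apply_bcontfun u \<longlonglongrightarrow> 0"
  by (simp add: c0_def)

lemma subspace_c0: "subspace c0"
proof (rule subspaceI)
  show "x + y \<in> c0" if "x \<in> c0" "y \<in> c0" for x y
    using tendsto_add[of "apply_bcontfun x" 0 sequentially "apply_bcontfun y" 0] that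
    by (simp add: c0_iff)
  show "r *\<^sub>R x \<in> c0" if "x \<in> c0" for r x
    using tendsto_mult_right_zero[of "apply_bcontfun x" sequentially r] that
    by (simp add: c0_iff)
qed (simp add: c0_iff)

lemma c0_exists:
  fixes a :: "nat \<Rightarrow> real"
  assumes "a \<longlonglongrightarrow> 0"
  shows "\<exists>u\<in>c0. apply_bcontfun u = a"
proof -
  have "continuous_on UNIV a" by simp
  moreover have "bounded (range a)" using assms by (rule convergent_imp_bounded)
  ultimately have "apply_bcontfun (Bcontfun a) = a"
    by (intro Bcontfun_inverse) (simp add: bcontfun_def)
  then show ?thesis using assms by (intro bexI[of _ "Bcontfun a"]) (simp_all add: c0_iff)
qed

text \<open>
  The pointwise limit is a null sequence, and hence bounded, because the convergence is uniform.
\<close>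
lemma Cauchy_c0_converges:
  assumes u: "\<And>n. u n \<in> c0" and "Cauchy u"
  shows "\<exists>w\<in>c0. u \<longlonglongrightarrow> w"
proof -
  have "convergent (\<lambda>n. apply_bcontfun (u n) k)" for k
  proof (rule Cauchy_convergent, rule metric_CauchyI)
    fix e :: real assume "0 < e"
    then obtain M where "\<forall>m\<ge>M. \<forall>n\<ge>M. dist (u m) (u n) < e"
      using metric_CauchyD[OF \<open>Cauchy u\<close>] by blast
    then show "\<exists>M. \<forall>m\<ge>M. \<forall>n\<ge>M. dist (apply_bcontfun (u m) k) (apply_bcontfun (u n) k) < e"
      using dist_fun_lt_imp_dist_val_lt by blast
  qed
  then have "\<exists>l. (\<lambda>n. apply_bcontfun (u n) k) \<longlonglongrightarrow> l" for k
    by (simp add: convergent_def)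
  then obtain a where a: "\<And>k. (\<lambda>n. apply_bcontfun (u n) k) \<longlonglongrightarrow> a k"
    by metis
  have unif: "\<exists>M. \<forall>n\<ge>M. \<forall>k. dist (apply_bcontfun (u n) k) (a k) \<le> e" if "0 < e" for e
  proof -
    obtain M where M: "\<And>m n. m \<ge> M \<Longrightarrow> n \<ge> M \<Longrightarrow> dist (u m) (u n) < e"
      using metric_CauchyD[OF \<open>Cauchy u\<close> \<open>0 < e\<close>] by blast
    have "dist (apply_bcontfun (u n) k) (a k) \<le> e" if "n \<ge> M" for n k
    proof (rule LIMSEQ_le_const2[OF tendsto_dist[OF tendsto_const a]], intro exI allI impI)
      fix m assume "M \<le> m"
      then show "dist (apply_bcontfun (u n) k) (apply_bcontfun (u m) k) \<le> e"
        using dist_bounded[of "u n" k "u m"] M[OF that, of m] by linarith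
    qed
    then show ?thesis by blast
  qed
  have "a \<longlonglongrightarrow> 0"
  proof (rule LIMSEQ_I)
    fix e :: real assume "0 < e"
    then obtain n where n: "\<And>k. dist (apply_bcontfun (u n) k) (a k) \<le> e / 2"
      using unif[of "e / 2"] by auto
    have "apply_bcontfun (u n) \<longlonglongrightarrow> 0" using u[of n] by (simp add: c0_iff)
    then obtain m where m: "\<And>k. k \<ge> m \<Longrightarrow> norm (apply_bcontfun (u n) k - 0) < e / 2"
      using LIMSEQ_D[of "apply_bcontfun (u n)" 0 "e / 2"] \<open>0 < e\<close> by auto
    have "norm (a k - 0) < e" if "k \<ge> m" for k
      using n[of k] m[OF that] unfolding dist_real_def real_norm_def by linarith
    then show "\<exists>m. \<forall>k\<ge>m. norm (a k - 0) < e" by blast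
  qed
  then obtain w where w: "w \<in> c0" "apply_bcontfun w = a" using c0_exists by blast
  have "u \<longlonglongrightarrow> w"
  proof (rule metric_LIMSEQ_I)
    fix e :: real assume "0 < e"
    then obtain M where M: "\<And>n k. n \<ge> M \<Longrightarrow> dist (apply_bcontfun (u n) k) (a k) \<le> e / 2"
      using unif[of "e / 2"] by auto
    have "dist (u n) w < e" if "n \<ge> M" for n
      using dist_bound[of "u n" w "e / 2"] M[OF that] w(2) \<open>0 < e\<close> by simp
    then show "\<exists>M. \<forall>n\<ge>M. dist (u n) w < e" by blast
  qed
  then show ?thesis using w(1) by blast
qed

text \<open>
  The two estimates say that \<open>u \<mapsto> \<Sum> u\<^sub>i h\<^sub>i\<close> converges on \<open>c\<^sub>0\<close> and is bi-Lipschitz there. Its range is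
  closed because \<open>c\<^sub>0\<close> is complete.
\<close>
lemma contains_copy_of_c0I:
  fixes h :: "nat \<Rightarrow> 'b::banach"
  assumes up: "\<And>n a. (\<And>i. \<bar>a i\<bar> \<le> 1) \<Longrightarrow> norm (\<Sum>i<n. a i *\<^sub>R h i) \<le> C"
    and lo: "\<And>n a k. k < n \<Longrightarrow> c * \<bar>a k\<bar> \<le> norm (\<Sum>i<n. a i *\<^sub>R h i)"
    and "c > 0"
  shows "contains_copy_of_c0 TYPE('b)"
proof -
  have "C \<ge> 0" using up[of "\<lambda>_. 0" 0] by simp
  have up_scaled: "norm (\<Sum>i<n. b i *\<^sub>R h i) \<le> C * M"
    if b: "\<And>i. i < n \<Longrightarrow> \<bar>b i\<bar> \<le> M" and M: "M > 0" for n b M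
  proof -
    have "norm (\<Sum>i<n. (if i < n then b i / M else 0) *\<^sub>R h i) \<le> C"
      using b M by (intro up) auto
    moreover have "(\<Sum>i<n. b i *\<^sub>R h i) = M *\<^sub>R (\<Sum>i<n. (if i < n then b i / M else 0) *\<^sub>R h i)"
      using M by (auto simp: scaleR_sum_right intro!: sum.cong)
    ultimately show ?thesis using M by simp
  qed
  define T where "T u = (\<Sum>i. apply_bcontfun u i *\<^sub>R h i)" for u :: "nat \<Rightarrow>\<^sub>C real"
  have summ: "summable (\<lambda>i. apply_bcontfun u i *\<^sub>R h i)" if u: "u \<in> c0" for u
    unfolding summable_Cauchy
  proof (intro allI impI)
    fix e :: real assume e: "e > 0"
    define d where "d = e / (C + 1)"
    have d: "d > 0" "C * d < e" using e \<open>C \<ge> 0\<close> by (auto simp: d_def field_simps)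
    obtain m where m: "\<And>i. i \<ge> m \<Longrightarrow> \<bar>apply_bcontfun u i\<bar> < d"
      using LIMSEQ_D[of "apply_bcontfun u" 0 d] u d by (auto simp: c0_iff)
    have "norm (sum (\<lambda>i. apply_bcontfun u i *\<^sub>R h i) {p..<n}) < e" if "p \<ge> m" for p n
    proof -
      have "sum (\<lambda>i. apply_bcontfun u i *\<^sub>R h i) {p..<n}
          = (\<Sum>i<n. (if p \<le> i then apply_bcontfun u i else 0) *\<^sub>R h i)"
        by (rule sum.mono_neutral_cong_left) auto
      also have "norm \<dots> \<le> C * d"
        using m that d(1) by (intro up_scaled) (auto intro!: less_imp_le)
      finally show ?thesis using d(2) by simp
    qed
    then show "\<exists>m. \<forall>p\<ge>m. \<forall>n. norm (sum (\<lambda>i. apply_bcontfun u i *\<^sub>R h i) {p..<n}) < e" by blast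
  qed
  then have lim: "(\<lambda>n. \<Sum>i<n. apply_bcontfun u i *\<^sub>R h i) \<longlonglongrightarrow> T u" if "u \<in> c0" for u
    unfolding T_def using summable_LIMSEQ that by blast
  have val_le: "\<bar>apply_bcontfun u i\<bar> \<le> norm u" for u :: "nat \<Rightarrow>\<^sub>C real" and i
    using norm_bounded[of u i] by simp
  have T_add: "T (u + v) = T u + T v" if "u \<in> c0" "v \<in> c0" for u v
    using suminf_add[OF summ[OF that(1)] summ[OF that(2)]] by (simp add: T_def scaleR_left_distrib)
  have T_scale: "T (r *\<^sub>R u) = r *\<^sub>R T u" if "u \<in> c0" for r u
    using suminf_scaleR_right[OF summ[OF that], of r] by (simp add: T_def)
  have T_diff: "T (u - v) = T u - T v" if "u \<in> c0" "v \<in> c0" for u v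
    using T_add[OF that(1) subspace_scale[OF subspace_c0 that(2), of "-1"]] T_scale[OF that(2), of "-1"]
    by simp
  have T_le: "norm (T u) \<le> C * norm u" if u: "u \<in> c0" for u
  proof (cases "norm u = 0")
    case True
    then show ?thesis by (simp add: T_def)
  next
    case False
    show ?thesis
    proof (rule LIMSEQ_le_const2[OF tendsto_norm[OF lim[OF u]]], intro exI allI impI)
      fix n
      show "norm (\<Sum>i<n. apply_bcontfun u i *\<^sub>R h i) \<le> C * norm u"
        using False val_le by (intro up_scaled) auto
    qed
  qed
  have T_ge: "c * norm u \<le> norm (T u)" if u: "u \<in> c0" for u
  proof -
    have "\<bar>apply_bcontfun u k\<bar> \<le> norm (T u) / c" for k
    proof -
      have "c * \<bar>apply_bcontfun u k\<bar> \<le> norm (T u)"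
      proof (rule LIMSEQ_le_const[OF tendsto_norm[OF lim[OF u]]], intro exI allI impI)
        fix n assume "Suc k \<le> n"
        then show "c * \<bar>apply_bcontfun u k\<bar> \<le> norm (\<Sum>i<n. apply_bcontfun u i *\<^sub>R h i)"
          by (intro lo) auto
      qed
      then show ?thesis using \<open>c > 0\<close> by (simp add: field_simps)
    qed
    then have "norm u \<le> norm (T u) / c" by (intro norm_bound) simp
    then show ?thesis using \<open>c > 0\<close> by (simp add: field_simps)
  qed
  have c0_diff: "u - v \<in> c0" if "u \<in> c0" "v \<in> c0" for u v
    using subspace_diff[OF subspace_c0] that .
  have dist_le: "dist (T u) (T v) \<le> C * dist u v" if "u \<in> c0" "v \<in> c0" for u v
    using T_le[OF c0_diff[OF that]] T_diff[OF that] by (simp add: dist_norm)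
  have dist_ge: "dist u v \<le> (1 / c) * dist (T u) (T v)" if "u \<in> c0" "v \<in> c0" for u v
    using T_ge[OF c0_diff[OF that]] T_diff[OF that] \<open>c > 0\<close> by (simp add: dist_norm field_simps)
  have inj: "inj_on T c0"
  proof (rule inj_onI)
    fix u v assume "u \<in> c0" "v \<in> c0" "T u = T v"
    then show "u = v" using dist_ge[of u v] by simp
  qed
  let ?S = "T ` c0"
  have "C-lipschitz_on c0 T" using dist_le \<open>C \<ge> 0\<close> by (intro lipschitz_onI)
  then have cont: "continuous_on c0 T" by (rule lipschitz_on_continuous_on)
  have "homeomorphism c0 ?S T (inv_into c0 T)"
  proof (rule homeomorphismI)
    show "continuous_on c0 T" by (rule cont)
    have "(1 / c)-lipschitz_on ?S (inv_into c0 T)"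
      using dist_ge \<open>c > 0\<close> inj by (intro lipschitz_onI) (auto simp: inv_into_f_f)
    then show "continuous_on ?S (inv_into c0 T)" by (rule lipschitz_on_continuous_on)
  qed (use inj in \<open>auto simp: inv_into_f_f\<close>)
  moreover have "subspace ?S"
  proof (rule subspaceI)
    show "0 \<in> ?S" using T_scale[of 0 0] subspace_0[OF subspace_c0] by force
    show "x + y \<in> ?S" if xy: "x \<in> ?S" "y \<in> ?S" for x y
    proof -
      obtain u v where uv: "u \<in> c0" "v \<in> c0" "x = T u" "y = T v" using xy by blast
      show ?thesis unfolding uv(3,4) T_add[OF uv(1,2), symmetric]
        by (intro imageI subspace_add[OF subspace_c0] uv)
    qed
    show "r *\<^sub>R x \<in> ?S" if x: "x \<in> ?S" for r x
    proof -
      obtain u where u: "u \<in> c0" "x = T u" using x by blast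
      show ?thesis unfolding u(2) T_scale[OF u(1), symmetric]
        by (intro imageI subspace_scale[OF subspace_c0] u)
    qed
  qed
  moreover have "closed ?S"
    unfolding closed_sequential_limits
  proof (intro allI impI, elim conjE)
    fix v l assume v: "\<forall>n. v n \<in> ?S" and l: "v \<longlonglongrightarrow> l"
    define u where "u n = inv_into c0 T (v n)" for n
    have u: "u n \<in> c0" "v n = T (u n)" for n
      unfolding u_def using v by (simp_all add: inv_into_into f_inv_into_f)
    have "Cauchy u"
    proof (rule metric_CauchyI)
      fix e :: real assume "e > 0"
      then have "c * e > 0" using \<open>c > 0\<close> by simp
      then obtain M where M: "\<And>m n. m \<ge> M \<Longrightarrow> n \<ge> M \<Longrightarrow> dist (v m) (v n) < c * e"
        using metric_CauchyD[OF LIMSEQ_imp_Cauchy[OF l]] by blast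
      have "dist (u m) (u n) < e" if "m \<ge> M" "n \<ge> M" for m n
      proof -
        have "c * dist (u m) (u n) \<le> dist (v m) (v n)"
          using dist_ge[OF u(1) u(1), of m n] \<open>c > 0\<close> by (simp add: u(2) field_simps)
        then have "c * dist (u m) (u n) < c * e" using M[OF that] by simp
        then show ?thesis using \<open>c > 0\<close> by simp
      qed
      then show "\<exists>M. \<forall>m\<ge>M. \<forall>n\<ge>M. dist (u m) (u n) < e" by blast
    qed
    then obtain w where "w \<in> c0" and w: "u \<longlonglongrightarrow> w"
      using Cauchy_c0_converges[of u] u(1) by blast
    have "(\<lambda>n. T (u n)) \<longlonglongrightarrow> T w"
      by (rule continuous_on_tendsto_compose[OF cont w \<open>w \<in> c0\<close>]) (simp add: u(1))
    then have "v \<longlonglongrightarrow> T w" by (simp only: u(2)[symmetric])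
    then have "l = T w" using l by (rule LIMSEQ_unique[rotated])
    then show "l \<in> ?S" using \<open>w \<in> c0\<close> by simp
  qed
  ultimately show ?thesis
    unfolding contains_copy_of_c0_def linearly_homeomorphic_def
    by (intro exI[of _ ?S] exI[of _ T] exI[of _ "inv_into c0 T"] conjI ballI allI T_add T_scale)
qed

lemma almost_square_imp_contains_copy_of_c0:
  fixes N :: "'b::banach \<Rightarrow> real"
  assumes eq: "equivalent_norm N" and sq: "almost_square N"
  shows "contains_copy_of_c0 TYPE('b)"
proof -
  from eq have N: "is_norm N" by (simp add: equivalent_norm_def)
  obtain a b where ab: "a > 0" "b > 0" "\<And>x. a * norm x \<le> N x" "\<And>x. N x \<le> b * norm x"
    using eq unfolding equivalent_norm_def by blast
  obtain h :: "nat \<Rightarrow> 'b" where h: "\<And>n. N (h n) = 1"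
      "\<And>n s. (\<forall>i. s i \<in> {-1, 1 :: real}) \<Longrightarrow> N (\<Sum>i<n. s i *\<^sub>R h i) \<le> 3 / 2"
    using almost_square_sign_sequence[OF N sq] by blast
  have up: "N (\<Sum>i<n. t i *\<^sub>R h i) \<le> 3 / 2" if "\<And>i. \<bar>t i\<bar> \<le> 1" for n and t :: "nat \<Rightarrow> real"
    using sign_sums_bound_imp_cube_sums_bound[OF N, of 0 h n "3 / 2" t] h(2) that by simp
  show ?thesis
  proof (rule contains_copy_of_c0I[of h "3 / 2 / a" "1 / 2 / b"])
    fix n k and t :: "nat \<Rightarrow> real"
    show "norm (\<Sum>i<n. t i *\<^sub>R h i) \<le> 3 / 2 / a" if "\<And>i. \<bar>t i\<bar> \<le> 1"
      using up[of t n, OF that] ab(3)[of "\<Sum>i<n. t i *\<^sub>R h i"] ab(1) by (simp add: field_simps)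
    assume "k < n"
    then have "(2 - 3 / 2) * \<bar>t k\<bar> \<le> N (\<Sum>i<n. t i *\<^sub>R h i)"
      using cube_sums_bound_imp_lower_bound[of N h "3 / 2" k n t] N h(1) up by simp
    then show "1 / 2 / b * \<bar>t k\<bar> \<le> norm (\<Sum>i<n. t i *\<^sub>R h i)"
      using ab(4)[of "\<Sum>i<n. t i *\<^sub>R h i"] ab(2) by (simp add: field_simps)
  qed (use ab in simp)
qed

section \<open>Almost biorthogonal sequences from copies of \<open>c\<^sub>0\<close>\<close>

lemma finite_large_terms:
  fixes f :: "nat \<Rightarrow> 'a::real_normed_vector \<Rightarrow>\<^sub>L real"
  assumes sum: "\<And>F. finite F \<Longrightarrow> (\<Sum>n\<in>F. \<bar>f n x\<bar>) \<le> C * norm x" and "0 < e"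
  shows "finite {n. e < \<bar>f n x\<bar>}"
proof (rule ccontr)
  assume inf: "infinite {n. e < \<bar>f n x\<bar>}"
  obtain k where k: "C * norm x / e < real k" using reals_Archimedean2 by blast
  obtain F where F: "finite F" "card F = k" "F \<subseteq> {n. e < \<bar>f n x\<bar>}"
    using infinite_arbitrarily_large[OF inf, of k] by blast
  have "real k * e = (\<Sum>n\<in>F. e)" using F by simp
  also have "\<dots> \<le> (\<Sum>n\<in>F. \<bar>f n x\<bar>)" using F by (intro sum_mono) auto
  also have "\<dots> \<le> C * norm x" using F by (intro sum)
  finally show False using k \<open>0 < e\<close> by (simp add: field_simps)
qed

text \<open>
  The \<open>f\<^sub>n\<close> are the images of the unit vectors. Choosing signs, \<open>\<Sum>\<^bsub>n\<in>F\<^esub> \<bar>f\<^sub>n x\<bar>\<close> is the value at \<open>x\<close> of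
  the image of a vector of norm at most one. The lower bound on \<open>\<parallel>f\<^sub>n\<parallel>\<close> provides \<open>z\<^sub>n\<close> of bounded norm.
\<close>
lemma contains_copy_of_c0_imp_unconditional_functionals:
  assumes "contains_copy_of_c0 TYPE('a::real_normed_vector \<Rightarrow>\<^sub>L real)"
  shows "\<exists>(f :: nat \<Rightarrow> 'a \<Rightarrow>\<^sub>L real) z C K. 0 < C \<and> 0 < K \<and>
    (\<forall>F x. finite F \<longrightarrow> (\<Sum>n\<in>F. \<bar>f n x\<bar>) \<le> C * norm x) \<and>
    (\<forall>n. f n (z n) = 1 \<and> norm (z n) \<le> K)"
proof -
  obtain S :: "('a \<Rightarrow>\<^sub>L real) set" and T g where
    hom: "homeomorphism c0 S T g"
    and add: "\<And>x y. x \<in> c0 \<Longrightarrow> y \<in> c0 \<Longrightarrow> T (x + y) = T x + T y"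
    and scale: "\<And>r x. x \<in> c0 \<Longrightarrow> T (r *\<^sub>R x) = r *\<^sub>R T x"
    using assms unfolding contains_copy_of_c0_def linearly_homeomorphic_def by blast
  have zero: "(0 :: nat \<Rightarrow>\<^sub>C real) \<in> c0" by (rule subspace_0[OF subspace_c0])
  have T0: "T 0 = 0" using scale[OF zero, of 0] by simp
  have TS: "T u \<in> S" and gT: "g (T u) = u" if "u \<in> c0" for u
    using hom that by (auto simp: homeomorphism_def)
  obtain d where d: "0 < d" "\<And>u. u \<in> c0 \<Longrightarrow> norm u < d \<Longrightarrow> norm (T u) < 1"
  proof -
    have "continuous_on c0 T" using hom by (simp add: homeomorphism_def)
    then obtain d where "0 < d" "\<forall>u\<in>c0. dist u 0 < d \<longrightarrow> dist (T u) (T 0) < 1"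
      unfolding continuous_on_iff using zero zero_less_one by blast
    then show ?thesis using that by (simp add: T0)
  qed
  have upper: "norm (T u) \<le> 2 / d * norm u" if u: "u \<in> c0" for u
  proof (cases "u = 0")
    case False
    let ?t = "d / 2 / norm u"
    have t: "0 < ?t" using False d by simp
    have "norm (T (?t *\<^sub>R u)) < 1"
      using False d(1) by (intro d(2) subspace_scale[OF subspace_c0] u) simp
    then have "?t * norm (T u) < 1" using t d(1) by (simp add: scale[OF u])
    then show ?thesis using False d(1) by (simp add: field_simps)
  qed (simp add: T0)
  obtain d' where d': "0 < d'" "\<And>u. u \<in> c0 \<Longrightarrow> norm (T u) < d' \<Longrightarrow> norm u < 1"
  proof -
    have "continuous_on S g" using hom by (simp add: homeomorphism_def)
    moreover have "0 \<in> S" using TS[OF zero] by (simp add: T0)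
    ultimately obtain d' where d': "0 < d'" "\<forall>v\<in>S. dist v 0 < d' \<longrightarrow> dist (g v) (g 0) < 1"
      unfolding continuous_on_iff using zero_less_one by blast
    have "g 0 = 0" using gT[OF zero] by (simp add: T0)
    then have "norm u < 1" if "u \<in> c0" "norm (T u) < d'" for u
      using bspec[OF d'(2) TS[OF that(1)]] gT[OF that(1)] that(2) by simp
    then show ?thesis using that d'(1) by blast
  qed
  have "\<exists>u\<in>c0. apply_bcontfun u = (\<lambda>m. if m = n then 1 else 0)" for n :: nat
  proof (rule c0_exists)
    have "\<forall>\<^sub>F m in sequentially. (if m = n then 1 else 0 :: real) = 0"
      using eventually_gt_at_top[of n] by eventually_elim auto
    then show "(\<lambda>m. if m = n then 1 else 0 :: real) \<longlonglongrightarrow> 0"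
      by (rule tendsto_eventually)
  qed
  then obtain e where e: "\<And>n. e n \<in> c0"
      "\<And>n. apply_bcontfun (e n) = (\<lambda>m :: nat. if m = n then 1 else 0)"
    by metis
  have comb: "(\<Sum>n\<in>F. s n *\<^sub>R e n) \<in> c0 \<and> T (\<Sum>n\<in>F. s n *\<^sub>R e n) = (\<Sum>n\<in>F. s n *\<^sub>R T (e n))
      \<and> (\<forall>m. apply_bcontfun (\<Sum>n\<in>F. s n *\<^sub>R e n) m = (if m \<in> F then s m else 0))"
    if "finite F" for F and s :: "nat \<Rightarrow> real"
    using that
  proof (induction F rule: finite_induct)
    case empty
    then show ?case using zero T0 by simp
  next
    case (insert n F)
    have "s n *\<^sub>R e n \<in> c0" by (intro subspace_scale[OF subspace_c0] e)
    with insert show ?case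
      using subspace_add[OF subspace_c0] by (simp add: add scale e)
  qed
  have sum_le: "(\<Sum>n\<in>F. \<bar>T (e n) x\<bar>) \<le> 2 / d * norm x" if F: "finite F" for F x
  proof -
    define s where "s n = sgn (blinfun_apply (T (e n)) x)" for n
    let ?u = "\<Sum>n\<in>F. s n *\<^sub>R e n"
    note u = comb[OF F, of s]
    have "norm ?u \<le> 1"
      using u by (intro norm_bound) (auto simp: s_def sgn_if)
    have "(\<Sum>n\<in>F. \<bar>T (e n) x\<bar>) = (\<Sum>n\<in>F. s n * T (e n) x)"
      by (simp add: s_def abs_sgn mult.commute)
    also have "\<dots> = blinfun_apply (T ?u) x"
      using u by (simp add: blinfun.sum_left blinfun.scaleR_left)
    also have "\<dots> \<le> norm (T ?u) * norm x" using norm_blinfun[of "T ?u" x] by simp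
    also have "norm (T ?u) \<le> 2 / d * norm ?u" using u upper by blast
    also have "2 / d * norm ?u \<le> 2 / d * 1"
      using d(1) \<open>norm ?u \<le> 1\<close> by (intro mult_left_mono) auto
    finally show ?thesis by (simp add: mult_right_mono)
  qed
  have "\<exists>z. T (e n) z = 1 \<and> norm z \<le> 2 / d'" for n
  proof (rule ccontr)
    assume neg: "\<not> ?thesis"
    have "norm (T (e n)) \<le> d' / 2"
    proof (rule norm_blinfun_bound)
      fix x
      show "norm (T (e n) x) \<le> d' / 2 * norm x"
      proof (rule ccontr)
        assume x: "\<not> ?thesis"
        define v where "v = T (e n) x"
        have v: "d' / 2 * norm x < \<bar>v\<bar>" using x by (simp add: v_def)
        then have "v \<noteq> 0" using d'(1) by (auto simp: mult_less_0_iff not_less)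
        have "T (e n) ((1 / v) *\<^sub>R x) = 1" using \<open>v \<noteq> 0\<close> by (simp add: blinfun.scaleR_right v_def)
        moreover have "norm ((1 / v) *\<^sub>R x) \<le> 2 / d'"
          using v \<open>v \<noteq> 0\<close> d'(1) by (simp add: field_simps)
        ultimately show False using neg by blast
      qed
    qed (use d' in simp)
    then have "norm (e n) < 1" using d' by (intro d'(2) e) auto
    moreover have "1 \<le> norm (e n)" using norm_bounded[of "e n" n] by (simp add: e)
    ultimately show False by simp
  qed
  then obtain z where "\<And>n. T (e n) (z n) = 1 \<and> norm (z n) \<le> 2 / d'" by metis
  then show ?thesis using d(1) d'(1) sum_le
    by (intro exI[of _ "\<lambda>n. T (e n)"] exI[of _ z] exI[of _ "2 / d"] exI[of _ "2 / d'"]) auto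
qed

text \<open>
  Since \<open>\<Sum>\<bar>f\<^sub>n x\<bar>\<close> converges, later functionals are small on earlier vectors as soon as their index is
  large. To make a new vector almost invisible to the finitely many earlier functionals, a difference
  \<open>z\<^sub>n - z\<^sub>m\<close> is used: by the pigeonhole principle the earlier functionals take almost the same values
  at \<open>z\<^sub>m\<close> and at infinitely many \<open>z\<^sub>n\<close>. For large \<open>n\<close> the value \<open>f\<^sub>n(z\<^sub>m)\<close> is at most \<open>1/2\<close>, so that the
  difference can be normalized at the cost of a factor two.
\<close>
lemma almost_biorthogonal_subsequence:
  fixes f :: "nat \<Rightarrow> 'a::real_normed_vector \<Rightarrow>\<^sub>L real"
  assumes C: "0 < C" and K: "0 < K"
    and sum: "\<And>F x. finite F \<Longrightarrow> (\<Sum>n\<in>F. \<bar>f n x\<bar>) \<le> C * norm x"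
    and z: "\<And>n. f n (z n) = 1" "\<And>n. norm (z n) \<le> K"
  shows "\<exists>(\<phi> :: nat \<Rightarrow> nat) y. inj \<phi> \<and>
    (\<forall>n. f (\<phi> n) (y n) = 1 \<and> norm (y n) \<le> 4 * K) \<and>
    (\<forall>n m. n \<noteq> m \<longrightarrow> \<bar>f (\<phi> n) (y m)\<bar> \<le> (1 / 2) ^ n)"
proof -
  define P where "P h l p \<longleftrightarrow> f (fst p) (snd p) = 1 \<and> norm (snd p) \<le> 4 * K \<and>
      (\<forall>k<l. \<bar>f (fst p) (snd (h k))\<bar> \<le> (1 / 2) ^ l \<and> \<bar>f (fst (h k)) (snd p)\<bar> \<le> (1 / 2) ^ l)"
    for h :: "nat \<Rightarrow> nat \<times> 'a" and l p
  have "\<exists>h. \<forall>l. P h l (h l)"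
  proof (rule dependent_wellorder_choice)
    show "P h l p = P h' l p" if "\<And>k. k < l \<Longrightarrow> h k = h' k" for p h h' l
      using that by (simp add: P_def)
    fix l :: nat and h :: "nat \<Rightarrow> nat \<times> 'a"
    define F where "F = fst ` h ` {..<l}"
    define e :: real where "e = (1 / 2) ^ l"
    have e: "0 < e" by (simp add: e_def)
    define B where "B = \<lceil>C * K / (e / 2)\<rceil> + 1"
    have bound: "\<bar>f n (z m)\<bar> \<le> C * K" for n m
    proof -
      have "\<bar>f n (z m)\<bar> \<le> C * norm (z m)" using sum[of "{n}" "z m"] by simp
      also have "\<dots> \<le> C * K" using C z by (intro mult_left_mono) auto
      finally show ?thesis .
    qed
    let ?\<Phi> = "\<lambda>m. \<lambda>n\<in>F. \<lfloor>f n (z m) / (e / 2)\<rfloor>"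
    have "?\<Phi> ` UNIV \<subseteq> (\<Pi>\<^sub>E n\<in>F. {-B..B})"
    proof (intro image_subsetI PiE_I)
      fix m n
      have "\<bar>f n (z m) / (e / 2)\<bar> \<le> C * K / (e / 2)"
        using bound[of n m] e by (simp add: divide_right_mono)
      then have "f n (z m) / (e / 2) \<le> C * K / (e / 2)" "- (C * K / (e / 2)) \<le> f n (z m) / (e / 2)"
        by linarith+
      then have "\<lfloor>f n (z m) / (e / 2)\<rfloor> \<in> {-B..B}" unfolding B_def atLeastAtMost_iff by linarith
      then show "n \<in> F \<Longrightarrow> ?\<Phi> m n \<in> {-B..B}" by simp
    qed auto
    moreover have "finite (\<Pi>\<^sub>E n\<in>F. {-B..B})" by (intro finite_PiE) (auto simp: F_def)
    ultimately have "finite (?\<Phi> ` UNIV)" by (rule finite_subset)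
    then obtain m where m: "infinite {n \<in> UNIV. ?\<Phi> n = ?\<Phi> m}"
      using pigeonhole_infinite[of UNIV ?\<Phi>] by auto
    define bad where "bad = {n. 1 / 2 < \<bar>f n (z m)\<bar>} \<union> (\<Union>k<l. {n. e < \<bar>f n (snd (h k))\<bar>})"
    have "finite bad"
      unfolding bad_def using e by (intro finite_UnI finite_UN_I finite_large_terms[OF sum]) auto
    from infinite_imp_nonempty[OF Diff_infinite_finite[OF this m]]
    obtain n where "n \<notin> bad" and n1: "?\<Phi> n = ?\<Phi> m" by blast
    then have n: "\<bar>f n (z m)\<bar> \<le> 1 / 2" "\<And>k. k < l \<Longrightarrow> \<bar>f n (snd (h k))\<bar> \<le> e"
      by (auto simp: bad_def not_less simp del: divide_le_eq_1 le_divide_eq_numeral1)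
    have close: "\<bar>f k (z n) - f k (z m)\<bar> \<le> e / 2" if "k \<in> F" for k
    proof -
      have "\<lfloor>f k (z n) / (e / 2)\<rfloor> = \<lfloor>f k (z m) / (e / 2)\<rfloor>"
        using fun_cong[OF n1, of k] that by simp
      then have "\<bar>f k (z n) / (e / 2) - f k (z m) / (e / 2)\<bar> \<le> 1" by linarith
      then have "\<bar>(f k (z n) - f k (z m)) / (e / 2)\<bar> \<le> 1" by (simp only: diff_divide_distrib)
      moreover have "\<bar>(f k (z n) - f k (z m)) / (e / 2)\<bar> = \<bar>f k (z n) - f k (z m)\<bar> / (e / 2)"
        unfolding abs_divide using e by simp
      ultimately have "\<bar>f k (z n) - f k (z m)\<bar> / (e / 2) \<le> 1" by linarith
      then show ?thesis using e by (simp add: divide_le_eq)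
    qed
    define t where "t = 1 / (1 - f n (z m))"
    have t: "0 < t" "t \<le> 2" using n(1) by (auto simp: t_def field_simps abs_le_iff)
    let ?y = "t *\<^sub>R (z n - z m)"
    have "P h l (n, ?y)"
      unfolding P_def fst_conv snd_conv
    proof (intro conjI allI impI)
      show "f n ?y = 1"
        using n(1) by (simp add: blinfun.scaleR_right blinfun.diff_right z t_def)
      have "norm (z n - z m) \<le> K + K"
        using norm_triangle_ineq4[of "z n" "z m"] z(2)[of n] z(2)[of m] by linarith
      then have "t * norm (z n - z m) \<le> 2 * (K + K)" using t by (intro mult_mono) auto
      then show "norm ?y \<le> 4 * K" using t by simp
      fix k assume k: "k < l"
      show "\<bar>f n (snd (h k))\<bar> \<le> (1 / 2) ^ l" using n(2)[OF k] by (simp add: e_def)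
      have "t * \<bar>f (fst (h k)) (z n) - f (fst (h k)) (z m)\<bar> \<le> 2 * (e / 2)"
        using t k by (intro mult_mono close) (auto simp: F_def)
      then show "\<bar>f (fst (h k)) ?y\<bar> \<le> (1 / 2) ^ l"
        using t by (simp add: blinfun.scaleR_right blinfun.diff_right abs_mult e_def)
    qed
    then show "\<exists>p. P h l p" by blast
  qed
  then obtain h where h: "\<And>l. P h l (h l)" by blast
  have one: "f (fst (h n)) (snd (h n)) = 1" "norm (snd (h n)) \<le> 4 * K" for n
    using h[of n] by (auto simp: P_def)
  have small: "\<bar>f (fst (h n)) (snd (h m))\<bar> \<le> (1 / 2) ^ n"
      "\<bar>f (fst (h n)) (snd (h m))\<bar> \<le> (1 / 2) ^ m" if "n \<noteq> m" for n m
  proof -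
    have "\<bar>f (fst (h n)) (snd (h m))\<bar> \<le> (1 / 2) ^ max n m"
    proof (cases "m < n")
      case True
      then show ?thesis using h[of n] by (simp add: P_def max_def)
    next
      case False
      then show ?thesis using h[of m] that by (simp add: P_def max_def)
    qed
    moreover have "(1 / 2 :: real) ^ max n m \<le> (1 / 2) ^ n" "(1 / 2 :: real) ^ max n m \<le> (1 / 2) ^ m"
      by (intro power_decreasing; simp)+
    ultimately show "\<bar>f (fst (h n)) (snd (h m))\<bar> \<le> (1 / 2) ^ n"
      "\<bar>f (fst (h n)) (snd (h m))\<bar> \<le> (1 / 2) ^ m" by linarith+
  qed
  have "inj (\<lambda>n. fst (h n))"
  proof (rule linorder_injI)
    fix k l :: nat assume "k < l"
    have "(1 / 2 :: real) ^ l \<le> (1 / 2) ^ 1" using \<open>k < l\<close> by (intro power_decreasing) auto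
    then show "fst (h k) \<noteq> fst (h l)"
      using small(1)[of l k] one(1)[of k] \<open>k < l\<close> by auto
  qed
  then show ?thesis using one small
    by (intro exI[of _ "\<lambda>n. fst (h n)"] exI[of _ "\<lambda>n. snd (h n)"]) auto
qed

lemma contains_copy_of_c0_imp_almost_biorthogonal:
  assumes "contains_copy_of_c0 TYPE('a::real_normed_vector \<Rightarrow>\<^sub>L real)"
  shows "\<exists>(f :: nat \<Rightarrow> 'a \<Rightarrow>\<^sub>L real) y C K. 0 < C \<and> 0 < K \<and>
    (\<forall>F x. finite F \<longrightarrow> (\<Sum>n\<in>F. \<bar>f n x\<bar>) \<le> C * norm x) \<and>
    (\<forall>n. f n (y n) = 1 \<and> norm (y n) \<le> K) \<and> (\<forall>n m. n \<noteq> m \<longrightarrow> \<bar>f n (y m)\<bar> \<le> (1 / 2) ^ n)"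
proof -
  obtain f :: "nat \<Rightarrow> 'a \<Rightarrow>\<^sub>L real" and z C K where fz: "0 < C \<and> 0 < K \<and>
      (\<forall>F x. finite F \<longrightarrow> (\<Sum>n\<in>F. \<bar>f n x\<bar>) \<le> C * norm x) \<and>
      (\<forall>n. f n (z n) = 1 \<and> norm (z n) \<le> K)"
    using contains_copy_of_c0_imp_unconditional_functionals[OF assms] by (elim exE) (rule that)
  then have CK: "0 < C" "0 < K"
    and sum: "\<And>F x. finite F \<Longrightarrow> (\<Sum>n\<in>F. \<bar>f n x\<bar>) \<le> C * norm x"
    and z: "\<And>n. f n (z n) = 1" "\<And>n. norm (z n) \<le> K"
    by simp_all
  obtain \<phi> :: "nat \<Rightarrow> nat" and y where y: "inj \<phi> \<and>
      (\<forall>n. f (\<phi> n) (y n) = 1 \<and> norm (y n) \<le> 4 * K) \<and>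
      (\<forall>n m. n \<noteq> m \<longrightarrow> \<bar>f (\<phi> n) (y m)\<bar> \<le> (1 / 2) ^ n)"
  proof -
    have "\<exists>(\<phi> :: nat \<Rightarrow> nat) y. inj \<phi> \<and> (\<forall>n. f (\<phi> n) (y n) = 1 \<and> norm (y n) \<le> 4 * K) \<and>
      (\<forall>n m. n \<noteq> m \<longrightarrow> \<bar>f (\<phi> n) (y m)\<bar> \<le> (1 / 2) ^ n)"
      by (rule almost_biorthogonal_subsequence[OF CK _ z], rule sum)
    then show ?thesis by (elim exE) (rule that)
  qed
  then have inj: "inj \<phi>" by simp
  have "(\<Sum>n\<in>F. \<bar>f (\<phi> n) x\<bar>) \<le> C * norm x" if "finite F" for F x
    using sum[of "\<phi> ` F" x] that by (simp add: sum.reindex inj_on_subset[OF inj subset_UNIV])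
  then show ?thesis using CK y
    by (intro exI[of _ "\<lambda>n. f (\<phi> n)"] exI[of _ y] exI[of _ C] exI[of _ "4 * K"]) simp
qed

section \<open>Dual norms as suprema over convex sets\<close>

definition minkowski :: "'a::real_vector set \<Rightarrow> 'a \<Rightarrow> real" where
  "minkowski K y = Inf {t. 0 < t \<and> (1 / t) *\<^sub>R y \<in> K}"

definition sup_abs_on :: "'a::real_normed_vector set \<Rightarrow> ('a \<Rightarrow>\<^sub>L real) \<Rightarrow> real" where
  "sup_abs_on K f = (SUP y\<in>K. \<bar>blinfun_apply f y\<bar>)"

context
  fixes K :: "'a::real_normed_vector set" and r M :: real
  assumes convex: "convex K" and sym: "\<And>y. y \<in> K \<Longrightarrow> - y \<in> K"
    and r: "0 < r" "\<And>y. norm y \<le> r \<Longrightarrow> y \<in> K"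
    and M: "0 < M" "\<And>y. y \<in> K \<Longrightarrow> norm y \<le> M"
begin

lemma minkowski_le: "0 < t \<Longrightarrow> (1 / t) *\<^sub>R y \<in> K \<Longrightarrow> minkowski K y \<le> t"
  unfolding minkowski_def by (intro cInf_lower) (auto intro!: bdd_belowI[of _ 0])

lemma scaled_mem: "0 < t \<Longrightarrow> norm y \<le> r * t \<Longrightarrow> (1 / t) *\<^sub>R y \<in> K"
  by (intro r(2)) (simp add: divide_le_eq)

lemma minkowski_nonempty: "\<exists>t. 0 < t \<and> (1 / t) *\<^sub>R y \<in> K"
proof -
  have "0 < norm y / r + 1" "norm y \<le> r * (norm y / r + 1)"
    using r(1) by (simp_all add: add_nonneg_pos distrib_left)
  then show ?thesis using scaled_mem by blast
qed

lemma minkowski_ge: "(\<And>t. 0 < t \<Longrightarrow> (1 / t) *\<^sub>R y \<in> K \<Longrightarrow> c \<le> t) \<Longrightarrow> c \<le> minkowski K y"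
  unfolding minkowski_def using minkowski_nonempty[of y] by (intro cInf_greatest) auto

lemma minkowski_less_imp_mem:
  assumes "minkowski K y < t"
  shows "(1 / t) *\<^sub>R y \<in> K"
proof -
  obtain s where s: "0 < s" "(1 / s) *\<^sub>R y \<in> K" "s < t"
    using minkowski_ge[of y t] assms by (meson not_le)
  have "(1 - s / t) *\<^sub>R 0 + (s / t) *\<^sub>R ((1 / s) *\<^sub>R y) \<in> K"
    using s r by (intro convexD[OF convex]) auto
  then show ?thesis using s by simp
qed

lemma norm_le_minkowski: "norm y \<le> M * minkowski K y"
proof -
  have "norm y / M \<le> minkowski K y"
  proof (rule minkowski_ge)
    fix t :: real assume "0 < t" "(1 / t) *\<^sub>R y \<in> K"
    then show "norm y / M \<le> t" using M(2)[of "(1 / t) *\<^sub>R y"] M(1) by (simp add: field_simps)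
  qed
  then show ?thesis using M(1) by (simp add: field_simps)
qed

lemma minkowski_le_norm: "minkowski K y \<le> norm y / r"
proof (rule field_le_epsilon)
  fix e :: real assume e: "0 < e"
  then have "0 < norm y / r + e" "norm y \<le> r * (norm y / r + e)"
    using r(1) by (simp_all add: add_nonneg_pos distrib_left)
  then show "minkowski K y \<le> norm y / r + e" by (intro minkowski_le scaled_mem)
qed

lemma minkowski_triangle: "minkowski K (x + y) \<le> minkowski K x + minkowski K y"
proof -
  have *: "minkowski K (x + y) \<le> s + t"
    if "0 < s" "(1 / s) *\<^sub>R x \<in> K" "0 < t" "(1 / t) *\<^sub>R y \<in> K" for s t
  proof (rule minkowski_le)
    have "s / (s + t) + t / (s + t) = (s + t) / (s + t)" by (simp only: add_divide_distrib)
    also have "\<dots> = 1" using that by simp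
    finally have "(s / (s + t)) *\<^sub>R ((1 / s) *\<^sub>R x) + (t / (s + t)) *\<^sub>R ((1 / t) *\<^sub>R y) \<in> K"
      using that by (intro convexD[OF convex]) simp_all
    moreover have "(s / (s + t)) *\<^sub>R ((1 / s) *\<^sub>R x) = (1 / (s + t)) *\<^sub>R x"
        "(t / (s + t)) *\<^sub>R ((1 / t) *\<^sub>R y) = (1 / (s + t)) *\<^sub>R y"
      using that by simp_all
    ultimately show "(1 / (s + t)) *\<^sub>R (x + y) \<in> K" by (simp only: scaleR_add_right)
  qed (use that in simp)
  have "minkowski K (x + y) - minkowski K x \<le> t" if "0 < t" "(1 / t) *\<^sub>R y \<in> K" for t
  proof -
    have "minkowski K (x + y) - t \<le> minkowski K x"
      using * that by (intro minkowski_ge) (simp add: diff_le_eq)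
    then show ?thesis by simp
  qed
  then have "minkowski K (x + y) - minkowski K x \<le> minkowski K y" by (rule minkowski_ge)
  then show ?thesis by simp
qed

lemma minkowski_minus: "minkowski K (- y) = minkowski K y"
proof -
  have "(1 / t) *\<^sub>R (- y) \<in> K \<longleftrightarrow> (1 / t) *\<^sub>R y \<in> K" for t
    using sym[of "(1 / t) *\<^sub>R y"] sym[of "(1 / t) *\<^sub>R (- y)"] by auto
  then show ?thesis by (simp only: minkowski_def)
qed

lemma minkowski_scale_le: "0 < a \<Longrightarrow> minkowski K (a *\<^sub>R y) \<le> a * minkowski K y"
proof -
  assume a: "0 < a"
  have "minkowski K (a *\<^sub>R y) / a \<le> minkowski K y"
  proof (rule minkowski_ge)
    fix t :: real assume t: "0 < t" "(1 / t) *\<^sub>R y \<in> K"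
    then have "minkowski K (a *\<^sub>R y) \<le> a * t" using a by (intro minkowski_le) auto
    then show "minkowski K (a *\<^sub>R y) / a \<le> t" using a by (simp add: field_simps)
  qed
  then show ?thesis using a by (simp add: field_simps)
qed

lemma equivalent_norm_minkowski: "equivalent_norm (minkowski K)"
proof -
  have nonneg: "0 \<le> minkowski K y" for y
    using norm_le_minkowski[of y] M(1) norm_ge_zero[of y] zero_le_mult_iff[of M "minkowski K y"]
    by linarith
  have zero: "minkowski K 0 = 0"
    using minkowski_le_norm[of 0] nonneg[of 0] by simp
  have pos_scale: "minkowski K (a *\<^sub>R y) = a * minkowski K y" if a: "0 < a" for a y
  proof (rule antisym[OF minkowski_scale_le[OF a]])
    have "minkowski K ((1 / a) *\<^sub>R (a *\<^sub>R y)) \<le> 1 / a * minkowski K (a *\<^sub>R y)"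
      using a by (intro minkowski_scale_le) simp
    then show "a * minkowski K y \<le> minkowski K (a *\<^sub>R y)" using a by (simp add: field_simps)
  qed
  have scale: "minkowski K (a *\<^sub>R y) = \<bar>a\<bar> * minkowski K y" for a y
  proof (cases "a = 0")
    case False
    then have "minkowski K (\<bar>a\<bar> *\<^sub>R y) = \<bar>a\<bar> * minkowski K y" by (intro pos_scale) simp
    moreover have "minkowski K (\<bar>a\<bar> *\<^sub>R y) = minkowski K (a *\<^sub>R y)"
      using minkowski_minus[of "a *\<^sub>R y"] by (simp add: abs_if)
    ultimately show ?thesis by simp
  qed (simp add: zero)
  have "y = 0" if "minkowski K y = 0" for y
    using norm_le_minkowski[of y] that by simp
  then have "is_norm (minkowski K)"
    unfolding is_norm_def using zero minkowski_triangle scale by blast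
  moreover have "1 / M * norm y \<le> minkowski K y" for y
    using norm_le_minkowski[of y] M(1) by (simp add: field_simps)
  moreover have "minkowski K y \<le> 1 / r * norm y" for y
    using minkowski_le_norm[of y] by simp
  ultimately show ?thesis
    unfolding equivalent_norm_def using M(1) r(1)
    by (intro conjI exI[of _ "1 / M"] exI[of _ "1 / r"]) auto
qed

lemma bdd_above_abs_on:
  fixes f :: "'a \<Rightarrow>\<^sub>L real"
  shows "bdd_above ((\<lambda>y. \<bar>blinfun_apply f y\<bar>) ` K)"
proof (rule bdd_aboveI2)
  fix y assume "y \<in> K"
  then have "norm f * norm y \<le> norm f * M" using M by (intro mult_left_mono) auto
  then show "\<bar>blinfun_apply f y\<bar> \<le> norm f * M" using norm_blinfun[of f y] by simp
qed

lemma abs_le_sup_abs_on: "y \<in> K \<Longrightarrow> \<bar>blinfun_apply f y\<bar> \<le> sup_abs_on K f"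
  unfolding sup_abs_on_def by (intro cSUP_upper bdd_above_abs_on)

lemma zero_mem: "0 \<in> K" using r by simp

lemma sup_abs_on_le: "(\<And>y. y \<in> K \<Longrightarrow> \<bar>blinfun_apply f y\<bar> \<le> c) \<Longrightarrow> sup_abs_on K f \<le> c"
  unfolding sup_abs_on_def using zero_mem by (intro cSUP_least) auto

lemma sup_abs_on_nonneg: "0 \<le> sup_abs_on K f"
  using abs_le_sup_abs_on[OF zero_mem, of f] by simp

text \<open>
  The unit ball of the Minkowski functional lies between \<open>K\<close> and every dilation \<open>t K\<close> with \<open>t > 1\<close>,
  so both sets give the same supremum.
\<close>
lemma dual_norm_of_minkowski: "dual_norm_of (minkowski K) = sup_abs_on K"
proof
  fix f :: "'a \<Rightarrow>\<^sub>L real"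
  have K_le: "minkowski K y \<le> 1" if "y \<in> K" for y
    using that by (intro minkowski_le) auto
  have le: "\<bar>blinfun_apply f y\<bar> \<le> sup_abs_on K f" if y: "minkowski K y \<le> 1" for y
  proof (rule field_le_epsilon)
    fix e :: real assume e: "0 < e"
    let ?s = "sup_abs_on K f"
    define t where "t = 1 + e / (?s + 1)"
    have t: "1 < t" using e sup_abs_on_nonneg[of f] by (simp add: t_def)
    have "(1 / t) *\<^sub>R y \<in> K" using t y by (intro minkowski_less_imp_mem) simp
    then have "\<bar>blinfun_apply f ((1 / t) *\<^sub>R y)\<bar> \<le> ?s" by (rule abs_le_sup_abs_on)
    then have "\<bar>blinfun_apply f y\<bar> \<le> t * ?s"
      using t by (simp add: blinfun.scaleR_right abs_mult field_simps)
    also have "t * ?s = ?s + e * (?s / (?s + 1))" by (simp add: t_def algebra_simps)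
    also have "\<dots> \<le> ?s + e * 1"
      using e sup_abs_on_nonneg[of f] by (intro add_left_mono mult_left_mono) auto
    finally show "\<bar>blinfun_apply f y\<bar> \<le> ?s + e" by simp
  qed
  show "dual_norm_of (minkowski K) f = sup_abs_on K f"
  proof (rule antisym)
    show "dual_norm_of (minkowski K) f \<le> sup_abs_on K f"
      unfolding dual_norm_of_def using K_le[OF zero_mem] le by (intro cSUP_least) auto
    have "bdd_above ((\<lambda>y. \<bar>blinfun_apply f y\<bar>) ` {y. minkowski K y \<le> 1})"
      using le by (intro bdd_aboveI2[where M = "sup_abs_on K f"]) auto
    then show "sup_abs_on K f \<le> dual_norm_of (minkowski K) f"
      unfolding dual_norm_of_def using K_le by (intro sup_abs_on_le cSUP_upper) auto
  qed
qed

lemma equivalent_norm_sup_abs_on: "equivalent_norm (sup_abs_on K)"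
proof -
  have lower: "r * norm f \<le> sup_abs_on K f" for f
  proof -
    have "norm f \<le> sup_abs_on K f / r"
    proof (rule norm_blinfun_bound)
      fix y
      show "norm (blinfun_apply f y) \<le> sup_abs_on K f / r * norm y"
      proof (cases "y = 0")
        case False
        have "(r / norm y) *\<^sub>R y \<in> K" using r False by (intro r(2)) simp
        from abs_le_sup_abs_on[OF this, of f] show ?thesis
          using False r(1) by (simp add: blinfun.scaleR_right abs_mult field_simps)
      qed simp
    qed (use r(1) sup_abs_on_nonneg in simp)
    then show ?thesis using r(1) by (simp add: field_simps)
  qed
  have upper: "sup_abs_on K f \<le> M * norm f" for f
  proof (rule sup_abs_on_le)
    fix y assume "y \<in> K"
    then have "norm f * norm y \<le> norm f * M" using M by (intro mult_left_mono) auto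
    then show "\<bar>blinfun_apply f y\<bar> \<le> M * norm f"
      using norm_blinfun[of f y] by (simp add: mult.commute)
  qed
  have zero: "sup_abs_on K 0 = 0" using upper[of 0] sup_abs_on_nonneg[of 0] by simp
  have triangle: "sup_abs_on K (f + g) \<le> sup_abs_on K f + sup_abs_on K g" for f g
  proof (rule sup_abs_on_le)
    fix y assume "y \<in> K"
    then show "\<bar>blinfun_apply (f + g) y\<bar> \<le> sup_abs_on K f + sup_abs_on K g"
      using abs_le_sup_abs_on[of y f] abs_le_sup_abs_on[of y g] by (simp add: blinfun.add_left)
  qed
  have scale_le: "sup_abs_on K (a *\<^sub>R f) \<le> \<bar>a\<bar> * sup_abs_on K f" for a f
  proof (rule sup_abs_on_le)
    fix y assume "y \<in> K"
    then show "\<bar>blinfun_apply (a *\<^sub>R f) y\<bar> \<le> \<bar>a\<bar> * sup_abs_on K f"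
      using abs_le_sup_abs_on[of y f] by (simp add: blinfun.scaleR_left abs_mult mult_left_mono)
  qed
  have scale: "sup_abs_on K (a *\<^sub>R f) = \<bar>a\<bar> * sup_abs_on K f" for a f
  proof (cases "a = 0")
    case False
    then have "\<bar>a\<bar> * sup_abs_on K f \<le> sup_abs_on K (a *\<^sub>R f)"
      using scale_le[of "1 / a" "a *\<^sub>R f"] by (simp add: field_simps)
    then show ?thesis using scale_le[of a f] by simp
  qed (simp add: zero)
  have "f = 0" if "sup_abs_on K f = 0" for f
    using lower[of f] that r(1) by (simp add: mult_le_0_iff)
  then have "is_norm (sup_abs_on K)"
    unfolding is_norm_def using zero triangle scale by blast
  then show ?thesis
    unfolding equivalent_norm_def using lower upper r(1) M(1) by blast
qed

lemma is_dual_norm_sup_abs_on: "is_dual_norm (sup_abs_on K)"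
  unfolding is_dual_norm_def using equivalent_norm_minkowski dual_norm_of_minkowski by metis

end

lemma abs_le_on_convex_hull:
  fixes f :: "'a::real_normed_vector \<Rightarrow>\<^sub>L real"
  assumes "\<And>y. y \<in> D \<Longrightarrow> \<bar>blinfun_apply f y\<bar> \<le> c" "y \<in> convex hull D"
  shows "\<bar>blinfun_apply f y\<bar> \<le> c"
proof -
  have "convex {y. \<bar>blinfun_apply f y\<bar> \<le> c}"
  proof (rule convexI)
    fix x y and u v :: real
    assume "x \<in> {y. \<bar>blinfun_apply f y\<bar> \<le> c}" "y \<in> {y. \<bar>blinfun_apply f y\<bar> \<le> c}"
      and uv: "0 \<le> u" "0 \<le> v" "u + v = 1"
    then have "u * \<bar>blinfun_apply f x\<bar> + v * \<bar>blinfun_apply f y\<bar> \<le> u * c + v * c"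
      by (intro add_mono mult_left_mono) auto
    also have "\<dots> = c" using uv by (metis distrib_right mult_1)
    finally show "u *\<^sub>R x + v *\<^sub>R y \<in> {y. \<bar>blinfun_apply f y\<bar> \<le> c}"
      using uv abs_triangle_ineq[of "u * blinfun_apply f x" "v * blinfun_apply f y"]
      by (simp add: blinfun.add_right blinfun.scaleR_right abs_mult)
  qed
  then have "convex hull D \<subseteq> {y. \<bar>blinfun_apply f y\<bar> \<le> c}"
    using assms(1) by (intro hull_minimal) auto
  then show ?thesis using assms(2) by blast
qed

section \<open>Rademacher functions on a finite cube\<close>

definition rademacher :: "nat \<Rightarrow> nat set \<Rightarrow> real" where
  "rademacher i A = (if i \<in> A then 1 else -1)"

lemma abs_rademacher [simp]: "\<bar>rademacher i A\<bar> = 1"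
  and rademacher_square [simp]: "rademacher i A * rademacher i A = 1"
  by (simp_all add: rademacher_def)

text \<open>
  Adding or removing the element \<open>i\<close> is an involution of the cube that changes the sign of every term.
\<close>
lemma rademacher_orthogonal:
  assumes "i < j" "i \<noteq> i'"
  shows "(\<Sum>A\<in>Pow {..<j}. rademacher i A * rademacher i' A) = 0"
proof -
  let ?flip = "\<lambda>A. if i \<in> A then A - {i} else insert i A"
  have "(\<Sum>A\<in>Pow {..<j}. rademacher i A * rademacher i' A)
      = (\<Sum>A\<in>Pow {..<j}. - (rademacher i A * rademacher i' A))"
    by (rule sum.reindex_bij_witness[of _ ?flip ?flip])
      (use assms in \<open>auto simp: rademacher_def split: if_splits\<close>)
  then show ?thesis by (simp add: sum_negf)
qed

lemma rademacher_inner: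
  assumes "i < j" "i' < j"
  shows "(\<Sum>A\<in>Pow {..<j}. rademacher i A * rademacher i' A) = (if i = i' then 2 ^ j else 0)"
  using rademacher_orthogonal[OF assms(1), of i'] by (simp add: card_Pow)

text \<open>
  This is Bessel's inequality. With \<open>S = \<Sum>\<^sub>i b\<^sub>i r\<^sub>i\<close>, which is \<open>2\<^sup>j\<close> times the projection of \<open>c\<close> onto the span
  of the Rademacher functions, it amounts to \<open>\<parallel>2\<^sup>j c - S\<parallel>\<^sup>2 \<ge> 0\<close>.
\<close>
lemma rademacher_bessel:
  fixes c :: "nat set \<Rightarrow> real"
  shows "(\<Sum>i<j. (\<Sum>A\<in>Pow {..<j}. rademacher i A * c A)\<^sup>2) \<le> 2 ^ j * (\<Sum>A\<in>Pow {..<j}. (c A)\<^sup>2)"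
proof -
  define b where "b i = (\<Sum>A\<in>Pow {..<j}. rademacher i A * c A)" for i
  define p :: real where "p = 2 ^ j"
  define S where "S A = (\<Sum>i<j. b i * rademacher i A)" for A
  have p: "0 < p" by (simp add: p_def)
  have cS: "(\<Sum>A\<in>Pow {..<j}. c A * S A) = (\<Sum>i<j. (b i)\<^sup>2)"
  proof -
    have "(\<Sum>A\<in>Pow {..<j}. c A * S A) = (\<Sum>A\<in>Pow {..<j}. \<Sum>i<j. b i * (rademacher i A * c A))"
      by (simp add: S_def sum_distrib_left mult_ac)
    also have "\<dots> = (\<Sum>i<j. b i * b i)"
      unfolding b_def by (subst sum.swap) (simp add: sum_distrib_left)
    finally show ?thesis by (simp add: power2_eq_square)
  qed
  have SS: "(\<Sum>A\<in>Pow {..<j}. S A * S A) = p * (\<Sum>i<j. (b i)\<^sup>2)"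
  proof -
    have "(\<Sum>A\<in>Pow {..<j}. S A * S A)
        = (\<Sum>A\<in>Pow {..<j}. \<Sum>i<j. \<Sum>i'<j. (b i * b i') * (rademacher i A * rademacher i' A))"
      by (simp add: S_def sum_product mult_ac)
    also have "\<dots> = (\<Sum>i<j. \<Sum>A\<in>Pow {..<j}. \<Sum>i'<j. (b i * b i') * (rademacher i A * rademacher i' A))"
      by (rule sum.swap)
    also have "\<dots> = (\<Sum>i<j. \<Sum>i'<j. \<Sum>A\<in>Pow {..<j}. (b i * b i') * (rademacher i A * rademacher i' A))"
      by (intro sum.cong refl sum.swap)
    also have "\<dots> = (\<Sum>i<j. \<Sum>i'<j. (b i * b i') * (if i = i' then p else 0))"
      by (intro sum.cong refl) (simp add: rademacher_inner p_def flip: sum_distrib_left)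
    also have "\<dots> = (\<Sum>i<j. (b i * b i) * p)"
    proof (intro sum.cong refl)
      fix i assume i: "i \<in> {..<j}"
      have "(\<Sum>i'<j. (b i * b i') * (if i = i' then p else 0)) = (\<Sum>i'<j. if i = i' then b i * b i' * p else 0)"
        by (intro sum.cong) auto
      then show "(\<Sum>i'<j. (b i * b i') * (if i = i' then p else 0)) = (b i * b i) * p"
        using i by simp
    qed
    finally show ?thesis by (simp add: power2_eq_square sum_distrib_left mult_ac)
  qed
  have "0 \<le> (\<Sum>A\<in>Pow {..<j}. (p * c A - S A)\<^sup>2)" by (intro sum_nonneg) simp
  also have "\<dots> = (\<Sum>A\<in>Pow {..<j}. p\<^sup>2 * (c A)\<^sup>2 - 2 * p * (c A * S A) + S A * S A)"
    by (intro sum.cong refl) (simp add: power2_eq_square algebra_simps)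
  also have "\<dots> = p\<^sup>2 * (\<Sum>A\<in>Pow {..<j}. (c A)\<^sup>2) - 2 * p * (\<Sum>A\<in>Pow {..<j}. c A * S A)
      + (\<Sum>A\<in>Pow {..<j}. S A * S A)"
    by (simp add: sum.distrib sum_subtractf sum_distrib_left)
  also have "\<dots> = p * (p * (\<Sum>A\<in>Pow {..<j}. (c A)\<^sup>2) - (\<Sum>i<j. (b i)\<^sup>2))"
    unfolding cS SS by (simp add: power2_eq_square algebra_simps)
  finally have "0 \<le> p * (\<Sum>A\<in>Pow {..<j}. (c A)\<^sup>2) - (\<Sum>i<j. (b i)\<^sup>2)"
    using p by (simp add: zero_le_mult_iff)
  then show ?thesis by (simp add: b_def p_def)
qed

text \<open>
  If every Rademacher function correlated with some \<open>c x\<close>, then summing the squared correlations over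
  all \<open>i\<close> and \<open>x\<close> would contradict Bessel's inequality.
\<close>
lemma rademacher_uncorrelated:
  fixes c :: "'x \<Rightarrow> nat set \<Rightarrow> real"
  assumes X: "finite X" and c: "\<And>x A. x \<in> X \<Longrightarrow> A \<subseteq> {..<j} \<Longrightarrow> \<bar>c x A\<bar> \<le> 1"
    and d: "0 < d" and j: "real (card X) / d\<^sup>2 < real j"
  shows "\<exists>i<j. \<forall>x\<in>X. \<bar>\<Sum>A\<in>Pow {..<j}. rademacher i A * c x A\<bar> \<le> d * 2 ^ j"
proof (rule ccontr)
  assume neg: "\<not> ?thesis"
  define b where "b x i = (\<Sum>A\<in>Pow {..<j}. rademacher i A * c x A)" for x i
  have one: "(d * 2 ^ j)\<^sup>2 \<le> (\<Sum>x\<in>X. (b x i)\<^sup>2)" if i: "i < j" for i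
  proof -
    obtain x where x: "x \<in> X" "d * 2 ^ j < \<bar>b x i\<bar>"
      using neg i unfolding b_def by (auto simp: not_le)
    then have "(d * 2 ^ j)\<^sup>2 \<le> (b x i)\<^sup>2"
      using d by (intro abs_le_square_iff[THEN iffD1]) simp
    also have "\<dots> \<le> (\<Sum>x\<in>X. (b x i)\<^sup>2)" using X x by (intro member_le_sum) auto
    finally show ?thesis .
  qed
  have "real j * (d * 2 ^ j)\<^sup>2 = (\<Sum>i<j. (d * 2 ^ j)\<^sup>2)" by simp
  also have "\<dots> \<le> (\<Sum>i<j. \<Sum>x\<in>X. (b x i)\<^sup>2)" by (intro sum_mono one) simp
  also have "\<dots> = (\<Sum>x\<in>X. \<Sum>i<j. (b x i)\<^sup>2)" by (rule sum.swap)
  also have "\<dots> \<le> (\<Sum>x\<in>X. 2 ^ j * 2 ^ j)"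
  proof (rule sum_mono)
    fix x assume x: "x \<in> X"
    have "(\<Sum>A\<in>Pow {..<j}. (c x A)\<^sup>2) \<le> (\<Sum>A\<in>Pow {..<j}. 1)"
      using c[OF x] by (intro sum_mono) (simp add: abs_square_le_1)
    then have "(\<Sum>A\<in>Pow {..<j}. (c x A)\<^sup>2) \<le> 2 ^ j" by (simp add: card_Pow)
    then have "2 ^ j * (\<Sum>A\<in>Pow {..<j}. (c x A)\<^sup>2) \<le> 2 ^ j * 2 ^ j" by (intro mult_left_mono) auto
    then show "(\<Sum>i<j. (b x i)\<^sup>2) \<le> 2 ^ j * 2 ^ j"
      using rademacher_bessel[where j = j and c = "c x"] unfolding b_def by linarith
  qed
  also have "\<dots> = real (card X) * (2 ^ j)\<^sup>2" by (simp add: power2_eq_square)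
  finally have "real j * d\<^sup>2 \<le> real (card X)" by (simp add: power_mult_distrib)
  then show False using j d by (simp add: field_simps)
qed

section \<open>The renorming\<close>

text \<open>
  The coordinate that belongs to the point \<open>A \<subseteq> {..<j}\<close> of the \<open>a\<close>-th block of level \<open>j\<close>.
\<close>
definition block_index :: "nat \<Rightarrow> nat \<Rightarrow> nat set \<Rightarrow> nat" where
  "block_index j a A = prod_encode (j, prod_encode (a, set_encode A))"

lemma block_index_eq_iff:
  assumes "A \<subseteq> {..<j}" "B \<subseteq> {..<k}"
  shows "block_index j a A = block_index k b B \<longleftrightarrow> j = k \<and> a = b \<and> A = B"
  using assms finite_subset[OF assms(1)] finite_subset[OF assms(2)]
  by (auto simp: block_index_def set_encode_eq)

text \<open>
  Far blocks consist of large coordinates, where the errors in the biorthogonality are small.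
\<close>
lemma block_le_block_index: "a \<le> block_index j a A"
  unfolding block_index_def by (meson le_prod_encode_1 le_prod_encode_2 order_trans)

text \<open>
  It suffices to find \<open>h\<close> with norm at least \<open>1 - \<epsilon>\<close>: with \<open>0\<close> added to the finite set, the norm is also
  at most \<open>1 + \<epsilon>\<close>, and normalizing \<open>h\<close> moves it by no more than \<open>\<epsilon>\<close>.
\<close>
lemma almost_squareI:
  assumes N: "is_norm N"
    and step: "\<And>X \<epsilon>. finite X \<Longrightarrow> (\<And>x. x \<in> X \<Longrightarrow> N x \<le> 1) \<Longrightarrow> 0 < \<epsilon> \<Longrightarrow>
      \<exists>h. 1 - \<epsilon> \<le> N h \<and> (\<forall>x\<in>X. N (x + h) \<le> 1 + \<epsilon> \<and> N (x - h) \<le> 1 + \<epsilon>)"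
  shows "almost_square N"
  unfolding almost_square_def
proof (intro allI impI, elim conjE)
  fix \<epsilon> :: real and X assume \<epsilon>: "0 < \<epsilon>" and X: "finite X" "X \<subseteq> {x. N x = 1}"
  define d where "d = min (1 / 2) (\<epsilon> / 2)"
  have d: "0 < d" "d \<le> 1 / 2" "2 * d \<le> \<epsilon>" using \<epsilon> by (auto simp: d_def)
  have "N 0 = 0" using N by (simp add: is_norm_def)
  then have "N x \<le> 1" if "x \<in> insert 0 X" for x using that X(2) by auto
  then have "\<exists>h. 1 - d \<le> N h \<and> (\<forall>x\<in>insert 0 X. N (x + h) \<le> 1 + d \<and> N (x - h) \<le> 1 + d)"
    using X(1) d(1) by (intro step) simp_all
  then obtain h where h: "1 - d \<le> N h"
      "\<And>x. x \<in> insert 0 X \<Longrightarrow> N (x + h) \<le> 1 + d \<and> N (x - h) \<le> 1 + d"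
    by blast
  have Nh: "1 - d \<le> N h" "N h \<le> 1 + d" using h(1) h(2)[of 0] by simp_all
  define g where "g = (1 / N h) *\<^sub>R h"
  have "0 < N h" using Nh d by linarith
  have scale: "N (r *\<^sub>R x) = \<bar>r\<bar> * N x" for r x using N by (simp add: is_norm_def)
  have Ng: "N g = 1" using \<open>0 < N h\<close> by (simp add: g_def scale)
  have "g - h = (1 / N h - 1) *\<^sub>R h" by (simp add: g_def scaleR_left_diff_distrib)
  then have "N (g - h) = \<bar>1 / N h - 1\<bar> * N h" by (simp add: scale)
  also have "\<dots> = \<bar>1 - N h\<bar>"
    using \<open>0 < N h\<close> by (simp add: abs_mult_pos field_simps)
  finally have gh: "N (g - h) \<le> d" "N (h - g) \<le> d"
    using Nh scale[of "-1" "g - h"] by auto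
  have "N (x + g) \<le> 1 + \<epsilon> \<and> N (x - g) \<le> 1 + \<epsilon>" if "x \<in> X" for x
  proof -
    have "N ((x + h) + (g - h)) \<le> N (x + h) + N (g - h)"
      "N ((x - h) + (h - g)) \<le> N (x - h) + N (h - g)"
      using N unfolding is_norm_def by blast+
    then show ?thesis using h(2)[of x] gh that d(3) by auto
  qed
  then show "\<exists>h. N h = 1 \<and> (\<forall>x\<in>X. N (x + h) \<le> 1 + \<epsilon> \<and> N (x - h) \<le> 1 + \<epsilon>)"
    using Ng by blast
qed

locale almost_biorthogonal =
  fixes f :: "nat \<Rightarrow> 'a::banach \<Rightarrow>\<^sub>L real" and y :: "nat \<Rightarrow> 'a" and C K :: real
  assumes C: "0 < C" and K: "0 < K"
    and sum_le: "\<And>F x. finite F \<Longrightarrow> (\<Sum>n\<in>F. \<bar>f n x\<bar>) \<le> C * norm x"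
    and diag: "\<And>n. f n (y n) = 1" and norm_y: "\<And>n. norm (y n) \<le> K"
    and off_diag: "\<And>n m. n \<noteq> m \<Longrightarrow> \<bar>f n (y m)\<bar> \<le> (1 / 2) ^ n"
begin

lemma summable_abs_f: "summable (\<lambda>n. \<bar>f n x\<bar>)"
  by (rule summableI_nonneg_bounded[of _ "C * norm x"]) (auto intro: sum_le)

lemma suminf_abs_f_le: "(\<Sum>n. \<bar>f n x\<bar>) \<le> C * norm x"
  by (intro suminf_le_const summable_abs_f sum_le) simp

text \<open>
  The formal series \<open>\<Sum> b\<^sub>n f\<^sub>n\<close> defines a functional of norm at most \<open>C sup \<bar>b\<^sub>n\<bar>\<close>: this is what is left of
  the copy of \<open>c\<^sub>0\<close>, extended from null sequences to bounded ones.
\<close>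
lemma weighted_sum_f:
  assumes "\<And>n. \<bar>b n\<bar> \<le> M"
  shows "summable (\<lambda>n. f n x * b n)" "\<bar>\<Sum>n. f n x * b n\<bar> \<le> C * M * norm x"
proof -
  have M: "0 \<le> M" using assms[of 0] by linarith
  have le: "norm (f n x * b n) \<le> \<bar>f n x\<bar> * M" for n
    using assms[of n] by (simp add: abs_mult mult_left_mono)
  have s: "summable (\<lambda>n. \<bar>f n x\<bar> * M)" by (intro summable_mult2 summable_abs_f)
  show "summable (\<lambda>n. f n x * b n)" by (rule summable_comparison_test'[OF s le])
  have "\<bar>\<Sum>n. f n x * b n\<bar> \<le> (\<Sum>n. \<bar>f n x\<bar> * M)"
    using norm_suminf_le[OF le s] by simp
  also have "\<dots> = (\<Sum>n. \<bar>f n x\<bar>) * M" by (rule suminf_mult2[OF summable_abs_f, symmetric])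
  also have "\<dots> \<le> C * norm x * M" using M by (intro mult_right_mono suminf_abs_f_le)
  finally show "\<bar>\<Sum>n. f n x * b n\<bar> \<le> C * M * norm x" by (simp add: mult_ac)
qed

text \<open>
  If the sequences were exactly biorthogonal, this would be a projection onto the closed span of the
  \<open>y\<^sub>n\<close>, which would be a copy of \<open>\<ell>\<^sub>1\<close>.
\<close>
definition quasi_proj :: "'a \<Rightarrow> 'a" where
  "quasi_proj x = (\<Sum>n. f n x *\<^sub>R y n)"

lemma summable_quasi_proj: "summable (\<lambda>n. f n x *\<^sub>R y n)"
proof (rule summable_comparison_test')
  show "summable (\<lambda>n. \<bar>f n x\<bar> * K)" by (intro summable_mult2 summable_abs_f)
  show "norm (f n x *\<^sub>R y n) \<le> \<bar>f n x\<bar> * K" for n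
    using norm_y by (simp add: mult_left_mono)
qed

lemma norm_quasi_proj_le: "norm (quasi_proj x) \<le> C * K * norm x"
proof -
  have "norm (quasi_proj x) \<le> (\<Sum>n. \<bar>f n x\<bar> * K)"
    unfolding quasi_proj_def
    using norm_y by (intro norm_suminf_le summable_mult2 summable_abs_f) (simp add: mult_left_mono)
  also have "\<dots> = (\<Sum>n. \<bar>f n x\<bar>) * K" by (rule suminf_mult2[OF summable_abs_f, symmetric])
  also have "\<dots> \<le> C * norm x * K" using K by (intro mult_right_mono suminf_abs_f_le) simp
  finally show ?thesis by (simp add: mult_ac)
qed

lemma apply_quasi_proj: "blinfun_apply g (quasi_proj x) = (\<Sum>n. f n x * g (y n))"
  unfolding quasi_proj_def
  by (subst bounded_linear.suminf[OF blinfun.bounded_linear_right summable_quasi_proj])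
    (simp add: blinfun.scaleR_right)

text \<open>
  The vectors at which a functional is evaluated to compute its new norm, listed in the order of the
  introduction. The last family makes the convex hull contain a ball, since \<open>x\<close> is the midpoint of
  \<open>2 x - Q(2 x)\<close> and \<open>Q(2 x)\<close>; its radius \<open>1 / (2 C)\<close> is such that \<open>\<bar>g(Q x)\<bar> \<le> C \<parallel>x\<parallel> sup \<bar>g(y\<^sub>n)\<bar>\<close> is
  at most half the supremum of the coordinates, so that the norm is that of the introduction.
\<close>
definition generators :: "'a set" where
  "generators = range (\<lambda>n. (1 / 2) *\<^sub>R y n)
    \<union> {(1 / real j) *\<^sub>R (\<Sum>a\<in>F. s a *\<^sub>R y (block_index j a (A a))) | j F s A.
        0 < j \<and> finite F \<and> card F = j \<and> (\<forall>a. \<bar>s a\<bar> \<le> 1) \<and> (\<forall>a. A a \<subseteq> {..<j})}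
    \<union> {(1 / 2 ^ j) *\<^sub>R (\<Sum>A\<in>Pow {..<j}. rademacher i A *\<^sub>R y (block_index j a A)) | j a i. i < j}
    \<union> {x - quasi_proj x | x. norm x \<le> 1}
    \<union> {quasi_proj x | x. norm x \<le> 1 / (2 * C)}"

definition predual_ball :: "'a set" where "predual_ball = convex hull (generators \<union> uminus ` generators)"

abbreviation N :: "('a \<Rightarrow>\<^sub>L real) \<Rightarrow> real" where "N \<equiv> sup_abs_on predual_ball"

lemma generators_subset_ball: "generators \<subseteq> predual_ball" and uminus_generators_subset_ball: "uminus ` generators \<subseteq> predual_ball"
  using hull_subset[of "generators \<union> uminus ` generators" convex] by (auto simp: predual_ball_def)

lemma convex_predual_ball: "convex predual_ball" by (simp add: predual_ball_def)

lemma uminus_mem_predual_ball: "x \<in> predual_ball \<Longrightarrow> - x \<in> predual_ball"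
proof -
  assume "x \<in> predual_ball"
  have "linear (uminus :: 'a \<Rightarrow> 'a)" by (simp add: linear_iff)
  then have "uminus ` predual_ball = convex hull (uminus ` (generators \<union> uminus ` generators))"
    unfolding predual_ball_def by (rule convex_hull_linear_image)
  also have "uminus ` (generators \<union> uminus ` generators) = generators \<union> uminus ` generators" by (auto simp: image_Un image_image)
  finally have "uminus ` predual_ball = predual_ball" by (simp add: predual_ball_def)
  then show ?thesis using \<open>x \<in> predual_ball\<close> by blast
qed

lemma norm_generator_le: "d \<in> generators \<Longrightarrow> norm d \<le> 1 + K + C * K"
proof -
  have CK: "0 < C * K" using C K by simp
  have comb: "norm ((1 / real (card I)) *\<^sub>R (\<Sum>i\<in>I. s i *\<^sub>R y (k i))) \<le> K"
    if "finite I" "\<And>i. i \<in> I \<Longrightarrow> \<bar>s i\<bar> \<le> 1" for I :: "'i set" and s k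
  proof -
    have "norm (\<Sum>i\<in>I. s i *\<^sub>R y (k i)) \<le> (\<Sum>i\<in>I. K)"
    proof (rule sum_norm_le)
      fix i assume "i \<in> I"
      then have "\<bar>s i\<bar> * norm (y (k i)) \<le> 1 * K" using that norm_y by (intro mult_mono) auto
      then show "norm (s i *\<^sub>R y (k i)) \<le> K" by simp
    qed
    then have "norm (\<Sum>i\<in>I. s i *\<^sub>R y (k i)) \<le> K * real (card I)" by (simp add: mult.commute)
    then show ?thesis using K by (cases "card I = 0") (simp_all add: divide_le_eq)
  qed
  assume "d \<in> generators"
  then consider n where "d = (1 / 2) *\<^sub>R y n"
    | j F s A where "d = (1 / real j) *\<^sub>R (\<Sum>a\<in>F. s a *\<^sub>R y (block_index j a (A a)))"
        "finite F" "card F = j" "\<forall>a. \<bar>s a\<bar> \<le> 1"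
    | j a i where "d = (1 / 2 ^ j) *\<^sub>R (\<Sum>A\<in>Pow {..<j}. rademacher i A *\<^sub>R y (block_index j a A))"
    | x where "d = x - quasi_proj x" "norm x \<le> 1"
    | x where "d = quasi_proj x" "norm x \<le> 1 / (2 * C)"
    unfolding generators_def by blast
  then show ?thesis
  proof cases
    case (1 n)
    then show ?thesis using norm_y[of n] K CK by simp
  next
    case (2 j F s A)
    then have "norm d \<le> K" using comb[of F s "\<lambda>a. block_index j a (A a)"] by simp
    then show ?thesis using CK by simp
  next
    case (3 j a i)
    then have "norm d \<le> K"
      using comb[of "Pow {..<j}" "rademacher i" "block_index j a"] by (simp add: card_Pow)
    then show ?thesis using CK by simp
  next
    case (4 x)
    have "C * K * norm x \<le> C * K * 1" using 4 CK by (intro mult_left_mono) auto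
    then show ?thesis
      using 4 norm_triangle_ineq4[of x "quasi_proj x"] norm_quasi_proj_le[of x] K by simp
  next
    case (5 x)
    have "C * K * norm x \<le> C * K * (1 / (2 * C))" using 5 CK by (intro mult_left_mono) auto
    also have "\<dots> = K / 2" using C by simp
    finally have "norm d \<le> K / 2" using 5(1) norm_quasi_proj_le[of x] by simp
    then show ?thesis using K CK by linarith
  qed
qed

lemma norm_predual_ball_le: "x \<in> predual_ball \<Longrightarrow> norm x \<le> 1 + K + C * K"
proof -
  have "predual_ball \<subseteq> cball 0 (1 + K + C * K)"
    unfolding predual_ball_def using norm_generator_le by (intro hull_minimal) auto
  then show "x \<in> predual_ball \<Longrightarrow> norm x \<le> 1 + K + C * K" by auto
qed

lemma small_ball_subset_predual_ball:
  assumes "norm x \<le> min (1 / 2) (1 / (4 * C))"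
  shows "x \<in> predual_ball"
proof -
  let ?z = "2 *\<^sub>R x"
  have "norm ?z \<le> 1" "norm ?z \<le> 1 / (2 * C)" using assms by auto
  then have "?z - quasi_proj ?z \<in> generators" "quasi_proj ?z \<in> generators" unfolding generators_def by blast+
  then have "(1 / 2) *\<^sub>R (?z - quasi_proj ?z) + (1 / 2) *\<^sub>R quasi_proj ?z \<in> predual_ball"
    using generators_subset_ball by (intro convexD[OF convex_predual_ball]) auto
  then show ?thesis by (simp add: scaleR_diff_right)
qed

lemma predual_ball_facts:
  "convex predual_ball" "\<And>x. x \<in> predual_ball \<Longrightarrow> - x \<in> predual_ball" "0 < min (1 / 2) (1 / (4 * C))"
  "\<And>x. norm x \<le> min (1 / 2) (1 / (4 * C)) \<Longrightarrow> x \<in> predual_ball"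
  "0 < 1 + K + C * K" "\<And>x. x \<in> predual_ball \<Longrightarrow> norm x \<le> 1 + K + C * K"
  using convex_predual_ball uminus_mem_predual_ball small_ball_subset_predual_ball norm_predual_ball_le C K by (auto intro!: add_pos_pos)

lemmas equivalent_norm_N = equivalent_norm_sup_abs_on[OF predual_ball_facts]
  and is_dual_norm_N = is_dual_norm_sup_abs_on[OF predual_ball_facts]

lemma is_norm_N: "is_norm N"
  using equivalent_norm_N by (simp add: equivalent_norm_def)

lemma abs_le_N: "d \<in> generators \<Longrightarrow> \<bar>blinfun_apply g d\<bar> \<le> N g"
  using generators_subset_ball by (intro abs_le_sup_abs_on[OF predual_ball_facts]) auto

lemma coordinate_le_N: "\<bar>blinfun_apply g (y n)\<bar> \<le> 2 * N g"
proof -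
  have "(1 / 2) *\<^sub>R y n \<in> generators" unfolding generators_def by blast
  from abs_le_N[OF this, of g] show ?thesis by (simp add: blinfun.scaleR_right)
qed

lemma transversal_le_N:
  assumes "0 < j" "finite F" "card F = j" "\<And>a. A a \<subseteq> {..<j}"
  shows "(\<Sum>a\<in>F. \<bar>blinfun_apply g (y (block_index j a (A a)))\<bar>) \<le> real j * N g"
proof -
  define s where "s a = sgn (blinfun_apply g (y (block_index j a (A a))))" for a
  have "\<bar>s a\<bar> \<le> 1" for a by (simp add: s_def sgn_if)
  then have "(1 / real j) *\<^sub>R (\<Sum>a\<in>F. s a *\<^sub>R y (block_index j a (A a))) \<in> generators"
    unfolding generators_def using assms by blast
  from abs_le_N[OF this, of g]
  have "\<bar>\<Sum>a\<in>F. s a * g (y (block_index j a (A a)))\<bar> \<le> real j * N g"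
    using assms(1) by (simp add: blinfun.scaleR_right blinfun.sum_right abs_mult field_simps)
  moreover have "(\<Sum>a\<in>F. s a * g (y (block_index j a (A a)))) = (\<Sum>a\<in>F. \<bar>g (y (block_index j a (A a)))\<bar>)"
    by (intro sum.cong refl) (simp add: s_def sgn_mult_abs mult.commute[of "sgn _"] abs_sgn)
  ultimately show ?thesis by linarith
qed

lemma rademacher_le_N:
  fixes g :: "'a \<Rightarrow>\<^sub>L real"
  assumes "i < j"
  shows "\<bar>\<Sum>A\<in>Pow {..<j}. rademacher i A * g (y (block_index j a A))\<bar> \<le> 2 ^ j * N g"
proof -
  have "(1 / 2 ^ j) *\<^sub>R (\<Sum>A\<in>Pow {..<j}. rademacher i A *\<^sub>R y (block_index j a A)) \<in> generators"
    unfolding generators_def using assms by blast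
  from abs_le_N[OF this, of g] show ?thesis
    by (simp add: blinfun.scaleR_right blinfun.sum_right abs_mult field_simps)
qed

lemma complement_le_N: "norm x \<le> 1 \<Longrightarrow> \<bar>blinfun_apply g (x - quasi_proj x)\<bar> \<le> N g"
  by (rule abs_le_N) (auto simp: generators_def)

text \<open>
  The value at \<open>Q x\<close> is a combination of coordinates, so the bound on the coordinates also covers the
  last family of generators.
\<close>
lemma N_le:
  fixes g :: "'a \<Rightarrow>\<^sub>L real"
  assumes coord: "\<And>n. \<bar>blinfun_apply g (y n)\<bar> \<le> 2 * t"
    and trans: "\<And>j F A. 0 < j \<Longrightarrow> finite F \<Longrightarrow> card F = j \<Longrightarrow> (\<And>a. A a \<subseteq> {..<j}) \<Longrightarrow>
      (\<Sum>a\<in>F. \<bar>blinfun_apply g (y (block_index j a (A a)))\<bar>) \<le> real j * t"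
    and rad: "\<And>i j a. i < j \<Longrightarrow>
      \<bar>\<Sum>A\<in>Pow {..<j}. rademacher i A * g (y (block_index j a A))\<bar> \<le> 2 ^ j * t"
    and compl: "\<And>x. norm x \<le> 1 \<Longrightarrow> \<bar>blinfun_apply g (x - quasi_proj x)\<bar> \<le> t"
  shows "N g \<le> t"
proof -
  have t: "0 \<le> t" using coord[of 0] by linarith
  have D_le: "\<bar>blinfun_apply g d\<bar> \<le> t" if "d \<in> generators" for d
  proof -
    from that consider n where "d = (1 / 2) *\<^sub>R y n"
      | j F s A where "d = (1 / real j) *\<^sub>R (\<Sum>a\<in>F. s a *\<^sub>R y (block_index j a (A a)))"
          "0 < j" "finite F" "card F = j" "\<forall>a. \<bar>s a\<bar> \<le> 1" "\<forall>a. A a \<subseteq> {..<j}"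
      | j a i where "d = (1 / 2 ^ j) *\<^sub>R (\<Sum>A\<in>Pow {..<j}. rademacher i A *\<^sub>R y (block_index j a A))" "i < j"
      | x where "d = x - quasi_proj x" "norm x \<le> 1"
      | x where "d = quasi_proj x" "norm x \<le> 1 / (2 * C)"
      unfolding generators_def by blast
    then show ?thesis
    proof cases
      case (1 n)
      then show ?thesis using coord[of n] by (simp add: blinfun.scaleR_right)
    next
      case (2 j F s A)
      have "\<bar>\<Sum>a\<in>F. s a * g (y (block_index j a (A a)))\<bar> \<le> (\<Sum>a\<in>F. \<bar>g (y (block_index j a (A a)))\<bar>)"
      proof (rule order_trans[OF sum_abs], rule sum_mono)
        fix a
        show "\<bar>s a * g (y (block_index j a (A a)))\<bar> \<le> \<bar>g (y (block_index j a (A a)))\<bar>"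
          using 2(5) by (simp add: abs_mult mult_left_le_one_le)
      qed
      also have "\<dots> \<le> real j * t" using 2 by (intro trans) auto
      finally show ?thesis
        using 2(1,2) by (simp add: blinfun.scaleR_right blinfun.sum_right abs_mult field_simps)
    next
      case (3 j a i)
      then show ?thesis using rad[OF 3(2), of a]
        by (simp add: blinfun.scaleR_right blinfun.sum_right abs_mult field_simps)
    next
      case (4 x)
      then show ?thesis using compl by simp
    next
      case (5 x)
      have "\<bar>blinfun_apply g (quasi_proj x)\<bar> \<le> C * (2 * t) * norm x"
        unfolding apply_quasi_proj using coord by (rule weighted_sum_f)
      also have "\<dots> \<le> C * (2 * t) * (1 / (2 * C))"
        using C t 5 by (intro mult_left_mono) auto
      also have "\<dots> = t" using C by simp
      finally show ?thesis using 5 by simp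
    qed
  qed
  have "\<bar>blinfun_apply g b\<bar> \<le> t" if "b \<in> predual_ball" for b
    using that unfolding predual_ball_def
    by (rule abs_le_on_convex_hull[rotated]) (auto simp: blinfun.minus_right intro: D_le)
  then show ?thesis by (intro sup_abs_on_le[OF predual_ball_facts])
qed

text \<open>
  The Rademacher function \<open>r\<^sub>i\<close> of the \<open>a\<close>-th block of level \<open>j\<close>, written in terms of the \<open>f\<^sub>n\<close>. Its
  coordinates are close to the exact Rademacher pattern defined next.
\<close>
definition bump :: "nat \<Rightarrow> nat \<Rightarrow> nat \<Rightarrow> 'a \<Rightarrow>\<^sub>L real" where
  "bump i j a = (\<Sum>A\<in>Pow {..<j}. rademacher i A *\<^sub>R f (block_index j a A))"

definition pattern :: "nat \<Rightarrow> nat \<Rightarrow> nat \<Rightarrow> nat \<Rightarrow> real" where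
  "pattern i j a m = (\<Sum>A\<in>Pow {..<j}. if m = block_index j a A then rademacher i A else 0)"

lemma pattern_block_index:
  assumes "A' \<subseteq> {..<j'}"
  shows "pattern i j a (block_index j' a' A') = (if j' = j \<and> a' = a then rademacher i A' else 0)"
proof -
  have "pattern i j a (block_index j' a' A')
      = (\<Sum>A\<in>Pow {..<j}. if j' = j \<and> a' = a \<and> A' = A then rademacher i A else 0)"
    unfolding pattern_def using assms by (intro sum.cong refl) (simp add: block_index_eq_iff)
  also have "\<dots> = (if j' = j \<and> a' = a then rademacher i A' else 0)"
    using assms by auto
  finally show ?thesis .
qed

lemma pattern_nonzeroE:
  assumes "pattern i j a m \<noteq> 0"
  obtains A where "A \<subseteq> {..<j}" "m = block_index j a A"
proof -
  from assms obtain A where "A \<in> Pow {..<j}" "(if m = block_index j a A then rademacher i A else 0) \<noteq> 0"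
    unfolding pattern_def by (rule sum.not_neutral_contains_not_neutral)
  then show ?thesis using that[of A] by (auto split: if_splits)
qed

lemma abs_pattern_le: "\<bar>pattern i j a m\<bar> \<le> 1"
proof (cases "pattern i j a m = 0")
  case False
  then obtain A where "A \<subseteq> {..<j}" "m = block_index j a A" by (rule pattern_nonzeroE)
  then show ?thesis by (simp add: pattern_block_index)
qed simp

text \<open>
  Each of the \<open>2\<^sup>j\<close> summands deviates from biorthogonality by at most \<open>(1/2)\<^sup>n\<close> where \<open>n \<ge> a\<close>.
\<close>
lemma bump_near_pattern: "\<bar>bump i j a (y m) - pattern i j a m\<bar> \<le> 2 ^ j * (1 / 2) ^ a"
proof -
  have "bump i j a (y m) - pattern i j a m
      = (\<Sum>A\<in>Pow {..<j}. rademacher i A * f (block_index j a A) (y m)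
          - (if m = block_index j a A then rademacher i A else 0))"
    by (simp add: bump_def pattern_def blinfun.sum_left blinfun.scaleR_left sum_subtractf)
  also have "\<bar>\<dots>\<bar> \<le> (\<Sum>A\<in>Pow {..<j}. (1 / 2) ^ a)"
  proof (rule order_trans[OF sum_abs], rule sum_mono)
    fix A
    let ?n = "block_index j a A"
    have "\<bar>rademacher i A * f ?n (y m) - (if m = ?n then rademacher i A else 0)\<bar> \<le> (1 / 2) ^ ?n"
    proof (cases "m = ?n")
      case True
      show ?thesis unfolding True using diag[of ?n] by simp
    next
      case False
      then show ?thesis using off_diag[of ?n m] by (simp add: abs_mult)
    qed
    also have "\<dots> \<le> (1 / 2) ^ a" by (intro power_decreasing block_le_block_index) auto
    finally show "\<bar>rademacher i A * f ?n (y m) - (if m = ?n then rademacher i A else 0)\<bar> \<le> (1 / 2) ^ a" .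
  qed
  finally show ?thesis by (simp add: card_Pow)
qed

lemma bump_sums: "(\<lambda>n. f n x * pattern i j a n) sums bump i j a x"
proof -
  have "(\<lambda>n. \<Sum>A\<in>Pow {..<j}. if n = block_index j a A then f n x * rademacher i A else 0)
      sums (\<Sum>A\<in>Pow {..<j}. f (block_index j a A) x * rademacher i A)"
  proof (rule sums_sum)
    fix A
    show "(\<lambda>n. if n = block_index j a A then f n x * rademacher i A else 0)
        sums (f (block_index j a A) x * rademacher i A)"
      by (rule sums_single)
  qed
  moreover have "(\<Sum>A\<in>Pow {..<j}. if n = block_index j a A then f n x * rademacher i A else 0)
      = f n x * pattern i j a n" for n
    by (simp add: pattern_def sum_distrib_left if_distrib[of "(*) _"] cong: if_cong)
  ultimately show ?thesis
    by (simp add: bump_def blinfun.sum_left blinfun.scaleR_left mult.commute)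
qed

text \<open>
  The bump \<open>h\<close> is the series with coefficients \<open>pattern\<close>, while \<open>h \<circ> Q\<close> is the series with coefficients
  \<open>h(y\<^sub>n)\<close>. These are uniformly close.
\<close>
lemma bump_complement_le:
  assumes "norm x \<le> 1"
  shows "\<bar>bump i j a (x - quasi_proj x)\<bar> \<le> C * (2 ^ j * (1 / 2) ^ a)"
proof -
  let ?h = "bump i j a" and ?w = "pattern i j a" and ?\<eta> = "2 ^ j * (1 / 2) ^ a :: real"
  have sw: "summable (\<lambda>n. f n x * ?w n)" using bump_sums by (rule sums_summable)
  have sd: "summable (\<lambda>n. f n x * (?h (y n) - ?w n))"
    using bump_near_pattern by (rule weighted_sum_f(1))
  have "?h (quasi_proj x) = (\<Sum>n. f n x * ?w n + f n x * (?h (y n) - ?w n))"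
    unfolding apply_quasi_proj by (simp add: algebra_simps)
  also have "\<dots> = ?h x + (\<Sum>n. f n x * (?h (y n) - ?w n))"
    using suminf_add[OF sw sd] sums_unique[OF bump_sums[where x = x and i = i and j = j and a = a]] by simp
  finally have "\<bar>?h (x - quasi_proj x)\<bar> = \<bar>\<Sum>n. f n x * (?h (y n) - ?w n)\<bar>"
    by (simp add: blinfun.diff_right)
  also have "\<dots> \<le> C * ?\<eta> * norm x"
    using bump_near_pattern by (rule weighted_sum_f(2))
  also have "\<dots> \<le> C * ?\<eta> * 1" using assms C by (intro mult_left_mono) auto
  finally show ?thesis by simp
qed

text \<open>
  Otherwise \<open>j\<close> blocks with a large coordinate in each would give an average above one.
\<close>
lemma finite_large_blocks:
  assumes "N g \<le> 1" "0 < j"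
  shows "finite {a. \<exists>A\<subseteq>{..<j}. 1 < \<bar>blinfun_apply g (y (block_index j a A))\<bar>}" (is "finite ?L")
proof (rule ccontr)
  assume "infinite ?L"
  then obtain F where F: "finite F" "card F = j" "F \<subseteq> ?L"
    using infinite_arbitrarily_large by blast
  define A where "A a = (SOME A. A \<subseteq> {..<j} \<and>
      (a \<in> ?L \<longrightarrow> 1 < \<bar>blinfun_apply g (y (block_index j a A))\<bar>))" for a
  have A: "A a \<subseteq> {..<j} \<and> (a \<in> ?L \<longrightarrow> 1 < \<bar>blinfun_apply g (y (block_index j a (A a)))\<bar>)" for a
    unfolding A_def by (rule someI_ex) blast
  have large: "1 < \<bar>blinfun_apply g (y (block_index j a (A a)))\<bar>" if "a \<in> F" for a
    using A[of a] F(3) that by blast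
  have "F \<noteq> {}" using F(2) assms(2) by auto
  have "real j = (\<Sum>a\<in>F. 1)" using F by simp
  also have "\<dots> < (\<Sum>a\<in>F. \<bar>blinfun_apply g (y (block_index j a (A a)))\<bar>)"
    using F(1) \<open>F \<noteq> {}\<close> large by (rule sum_strict_mono)
  also have "\<dots> \<le> real j * N g" using A F assms(2) by (intro transversal_le_N) auto
  also have "\<dots> \<le> real j * 1" using assms(1) by (intro mult_left_mono) auto
  finally show False by simp
qed

text \<open>
  Up to the biorthogonality errors, a bump touches at most one point in each average, so it costs at
  most \<open>1/j \<le> \<epsilon>/2\<close> there; by orthogonality only its own Rademacher coefficient changes, and to that
  one \<open>g\<close> contributes at most \<open>\<epsilon>/2\<close>.
\<close>
lemma N_add_bump_le:
  assumes g: "N g \<le> 1" and block: "\<And>A. A \<subseteq> {..<j} \<Longrightarrow> \<bar>blinfun_apply g (y (block_index j a A))\<bar> \<le> 1"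
    and i: "i < j"
    and corr: "\<bar>\<Sum>A\<in>Pow {..<j}. rademacher i A * g (y (block_index j a A))\<bar> \<le> \<epsilon> / 2 * 2 ^ j"
    and j: "1 \<le> real j * (\<epsilon> / 2)"
    and small: "2 ^ j * (1 / 2) ^ a \<le> \<epsilon> / 2" "C * (2 ^ j * (1 / 2) ^ a) \<le> \<epsilon>"
    and \<sigma>: "\<bar>\<sigma>\<bar> = 1"
  shows "N (g + \<sigma> *\<^sub>R bump i j a) \<le> 1 + \<epsilon>"
proof -
  let ?w = "pattern i j a" and ?u = "g + \<sigma> *\<^sub>R bump i j a"
  have "0 < real j * (\<epsilon> / 2)" using j by linarith
  then have \<epsilon>: "0 \<le> \<epsilon>" by (simp add: zero_less_mult_iff)
  have near: "\<bar>?u (y m) - (g (y m) + \<sigma> * ?w m)\<bar> \<le> \<epsilon> / 2" for m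
  proof -
    have "?u (y m) - (g (y m) + \<sigma> * ?w m) = \<sigma> * (bump i j a (y m) - ?w m)"
      by (simp add: blinfun.add_left blinfun.scaleR_left algebra_simps)
    then show ?thesis using bump_near_pattern[of i j a m] small(1) \<sigma> by (simp add: abs_mult)
  qed
  have coord: "\<bar>?u (y m)\<bar> \<le> \<bar>g (y m)\<bar> + \<bar>?w m\<bar> + \<epsilon> / 2" for m
  proof -
    have "\<bar>\<sigma> * ?w m\<bar> = \<bar>?w m\<bar>" using \<sigma> by (simp add: abs_mult)
    then show ?thesis using near[of m] by linarith
  qed
  show ?thesis
  proof (rule N_le)
    fix m
    show "\<bar>?u (y m)\<bar> \<le> 2 * (1 + \<epsilon>)"
    proof (cases "?w m = 0")
      case True
      then show ?thesis using coord[of m] coordinate_le_N[of g m] g \<epsilon> by simp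
    next
      case False
      then have "\<bar>g (y m)\<bar> \<le> 1" using block by (metis pattern_nonzeroE)
      then show ?thesis using coord[of m] abs_pattern_le[of i j a m] \<epsilon> by simp
    qed
  next
    fix j' :: nat and F :: "nat set" and A :: "nat \<Rightarrow> nat set" assume F: "0 < j'" "finite F" "card F = j'" and A: "\<And>a. A a \<subseteq> {..<j'}"
    have "(\<Sum>b\<in>F. \<bar>?u (y (block_index j' b (A b)))\<bar>)
        \<le> (\<Sum>b\<in>F. \<bar>g (y (block_index j' b (A b)))\<bar> + \<bar>?w (block_index j' b (A b))\<bar> + \<epsilon> / 2)"
      by (intro sum_mono coord)
    also have "\<dots> = (\<Sum>b\<in>F. \<bar>g (y (block_index j' b (A b)))\<bar>) + (\<Sum>b\<in>F. \<bar>?w (block_index j' b (A b))\<bar>)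
        + real j' * (\<epsilon> / 2)"
      using F by (simp add: sum.distrib)
    also have "\<dots> \<le> real j' * 1 + real j' * (\<epsilon> / 2) + real j' * (\<epsilon> / 2)"
    proof (intro add_mono order_refl)
      have "(\<Sum>b\<in>F. \<bar>g (y (block_index j' b (A b)))\<bar>) \<le> real j' * N g"
        by (rule transversal_le_N[OF F A])
      also have "\<dots> \<le> real j' * 1" using g by (intro mult_left_mono) auto
      finally show "(\<Sum>b\<in>F. \<bar>g (y (block_index j' b (A b)))\<bar>) \<le> real j' * 1" .
      show "(\<Sum>b\<in>F. \<bar>?w (block_index j' b (A b))\<bar>) \<le> real j' * (\<epsilon> / 2)"
      proof (cases "j' = j")
        case True
        have "(\<Sum>b\<in>F. \<bar>?w (block_index j' b (A b))\<bar>) = (\<Sum>b\<in>F. if b = a then 1 else 0)"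
          using A True by (intro sum.cong refl) (simp add: pattern_block_index)
        also have "\<dots> \<le> 1" using F by simp
        finally show ?thesis using j True by simp
      next
        case False
        then have "(\<Sum>b\<in>F. \<bar>?w (block_index j' b (A b))\<bar>) = 0"
          using A by (intro sum.neutral) (simp add: pattern_block_index)
        then show ?thesis using \<epsilon> by simp
      qed
    qed
    finally show "(\<Sum>b\<in>F. \<bar>?u (y (block_index j' b (A b)))\<bar>) \<le> real j' * (1 + \<epsilon>)"
      by (simp add: algebra_simps)
  next
    fix i' j' b assume i': "i' < (j' :: nat)"
    let ?r = "rademacher i'" and ?m = "block_index j' b" and ?P = "Pow {..<j'}"
    have err: "\<bar>(\<Sum>A\<in>?P. ?r A * ?u (y (?m A))) - ((\<Sum>A\<in>?P. ?r A * g (y (?m A))) + \<sigma> * (\<Sum>A\<in>?P. ?r A * ?w (?m A)))\<bar>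
        \<le> 2 ^ j' * (\<epsilon> / 2)"
    proof -
      have "(\<Sum>A\<in>?P. ?r A * ?u (y (?m A))) - ((\<Sum>A\<in>?P. ?r A * g (y (?m A))) + \<sigma> * (\<Sum>A\<in>?P. ?r A * ?w (?m A)))
          = (\<Sum>A\<in>?P. ?r A * (?u (y (?m A)) - (g (y (?m A)) + \<sigma> * ?w (?m A))))"
        by (simp only: sum_distrib_left sum.distrib[symmetric] sum_subtractf[symmetric])
          (intro sum.cong refl, simp add: algebra_simps)
      also have "\<bar>\<dots>\<bar> \<le> (\<Sum>A\<in>?P. \<epsilon> / 2)"
        by (rule order_trans[OF sum_abs], rule sum_mono) (simp only: abs_mult abs_rademacher mult_1 near)
      finally show ?thesis by (simp add: card_Pow)
    qed
    have corr_g: "\<bar>\<Sum>A\<in>?P. ?r A * g (y (?m A))\<bar> \<le> 2 ^ j'"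
    proof -
      have "\<bar>\<Sum>A\<in>?P. ?r A * g (y (?m A))\<bar> \<le> 2 ^ j' * N g" by (rule rademacher_le_N[OF i'])
      also have "\<dots> \<le> 2 ^ j' * 1" using g by (intro mult_left_mono) auto
      finally show ?thesis by simp
    qed
    have corr_w: "(\<Sum>A\<in>?P. ?r A * ?w (?m A)) = (if j' = j \<and> b = a \<and> i' = i then 2 ^ j' else 0)"
    proof -
      have "(\<Sum>A\<in>?P. ?r A * ?w (?m A))
          = (\<Sum>A\<in>?P. if j' = j \<and> b = a then ?r A * rademacher i A else 0)"
        by (intro sum.cong refl) (simp add: pattern_block_index)
      also have "\<dots> = (if j' = j \<and> b = a \<and> i' = i then 2 ^ j' else 0)"
      proof (cases "j' = j \<and> b = a")
        case True
        then show ?thesis using rademacher_inner[OF i', of i] i by simp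
      next
        case False
        then have *: "(\<Sum>A\<in>?P. if j' = j \<and> b = a then ?r A * rademacher i A else 0) = 0"
          by (intro sum.neutral) auto
        show ?thesis unfolding * using False by auto
      qed
      finally show ?thesis .
    qed
    show "\<bar>\<Sum>A\<in>?P. ?r A * ?u (y (?m A))\<bar> \<le> 2 ^ j' * (1 + \<epsilon>)"
    proof (cases "j' = j \<and> b = a \<and> i' = i")
      case True
      have "\<bar>\<sigma> * (\<Sum>A\<in>?P. ?r A * ?w (?m A))\<bar> = 2 ^ j'"
        unfolding corr_w using True \<sigma> by (simp add: abs_mult)
      moreover have "\<bar>\<Sum>A\<in>?P. ?r A * g (y (?m A))\<bar> \<le> 2 ^ j' * (\<epsilon> / 2)"
        using corr True by (simp add: mult.commute)
      ultimately have "\<bar>\<Sum>A\<in>?P. ?r A * ?u (y (?m A))\<bar> \<le> 2 ^ j' + 2 ^ j' * (\<epsilon> / 2) + 2 ^ j' * (\<epsilon> / 2)"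
        using err by linarith
      then show ?thesis by (simp add: algebra_simps)
    next
      case False
      then have "\<sigma> * (\<Sum>A\<in>?P. ?r A * ?w (?m A)) = 0" unfolding corr_w by auto
      then have "\<bar>\<Sum>A\<in>?P. ?r A * ?u (y (?m A))\<bar> \<le> 2 ^ j' + 2 ^ j' * (\<epsilon> / 2)"
        using err corr_g by linarith
      also have "\<dots> \<le> 2 ^ j' * (1 + \<epsilon>)" using \<epsilon> by (simp add: algebra_simps)
      finally show ?thesis .
    qed
  next
    fix x :: 'a assume x: "norm x \<le> 1"
    have "?u (x - quasi_proj x) = g (x - quasi_proj x) + \<sigma> * bump i j a (x - quasi_proj x)"
      by (simp add: blinfun.add_left blinfun.scaleR_left)
    moreover have "\<bar>\<sigma> * bump i j a (x - quasi_proj x)\<bar> \<le> \<epsilon>"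
      using bump_complement_le[OF x, of i j a] small(2) \<sigma> by (simp add: abs_mult)
    moreover have "\<bar>g (x - quasi_proj x)\<bar> \<le> 1" using complement_le_N[OF x, of g] g by linarith
    ultimately show "\<bar>?u (x - quasi_proj x)\<bar> \<le> 1 + \<epsilon>" by linarith
  qed
qed

lemma N_bump_ge:
  assumes "i < j"
  shows "1 - 2 ^ j * (1 / 2) ^ a \<le> N (bump i j a)"
proof -
  let ?h = "bump i j a" and ?\<eta> = "2 ^ j * (1 / 2) ^ a :: real" and ?P = "Pow {..<j}"
  have "(\<Sum>A\<in>?P. 1 - ?\<eta>) \<le> (\<Sum>A\<in>?P. rademacher i A * ?h (y (block_index j a A)))"
  proof (rule sum_mono)
    fix A assume "A \<in> ?P"
    then have "\<bar>?h (y (block_index j a A)) - rademacher i A\<bar> \<le> ?\<eta>"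
      using bump_near_pattern[of i j a "block_index j a A"] by (simp add: pattern_block_index)
    then have "\<bar>rademacher i A * (?h (y (block_index j a A)) - rademacher i A)\<bar> \<le> ?\<eta>"
      by (simp add: abs_mult)
    then show "1 - ?\<eta> \<le> rademacher i A * ?h (y (block_index j a A))"
      by (simp add: right_diff_distrib)
  qed
  moreover have "(\<Sum>A\<in>?P. 1 - ?\<eta>) = 2 ^ j * (1 - ?\<eta>)" by (simp add: card_Pow)
  ultimately have "2 ^ j * (1 - ?\<eta>) \<le> 2 ^ j * N ?h"
    using rademacher_le_N[OF assms, of ?h a] by linarith
  then show ?thesis by (rule mult_left_le_imp_le) simp
qed

text \<open>
  The level \<open>j\<close> is chosen first, large enough for the averages and for Bessel's inequality. Only then
  is the block chosen, far out and away from the finitely many blocks on which some \<open>x \<in> X\<close> is large.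
\<close>
lemma almost_square_N: "almost_square N"
proof (rule almost_squareI[OF is_norm_N])
  fix X and \<epsilon> :: real
  assume X: "finite X" "\<And>x. x \<in> X \<Longrightarrow> N x \<le> 1" and \<epsilon>: "0 < \<epsilon>"
  obtain j where j: "max (real (card X) / (\<epsilon> / 2)\<^sup>2) (1 / (\<epsilon> / 2)) < real j"
    using reals_Archimedean2 by blast
  then have j1: "real (card X) / (\<epsilon> / 2)\<^sup>2 < real j" "1 / (\<epsilon> / 2) < real j" by simp_all
  have j2: "1 \<le> real j * (\<epsilon> / 2)" using j1(2) \<epsilon> by (simp add: field_simps)
  have "0 < j" using j1(2) \<epsilon> by (cases j) (simp_all add: field_simps)
  define \<eta> where "\<eta> = min (\<epsilon> / 2) (\<epsilon> / C)"
  have \<eta>: "0 < \<eta>" using \<epsilon> C by (simp add: \<eta>_def)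
  have "(\<lambda>a. 2 ^ j * (1 / 2 :: real) ^ a) \<longlonglongrightarrow> 0"
    by (intro tendsto_mult_right_zero LIMSEQ_power_zero) simp
  then obtain a0 where a0: "\<And>a. a \<ge> a0 \<Longrightarrow> norm (2 ^ j * (1 / 2 :: real) ^ a - 0) < \<eta>"
    using LIMSEQ_D[OF _ \<eta>] by blast
  have "finite ({..<a0} \<union> (\<Union>x\<in>X. {a. \<exists>A\<subseteq>{..<j}. 1 < \<bar>blinfun_apply x (y (block_index j a A))\<bar>}))"
    using X \<open>0 < j\<close> by (intro finite_UnI finite_UN_I finite_large_blocks) auto
  then obtain a where "a \<notin> {..<a0} \<union> (\<Union>x\<in>X. {a. \<exists>A\<subseteq>{..<j}. 1 < \<bar>blinfun_apply x (y (block_index j a A))\<bar>})"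
    using ex_new_if_finite[OF infinite_UNIV_nat] by blast
  then have a: "a \<ge> a0" and
    block: "\<And>x A. x \<in> X \<Longrightarrow> A \<subseteq> {..<j} \<Longrightarrow> \<bar>blinfun_apply x (y (block_index j a A))\<bar> \<le> 1"
    by (auto simp: not_less)
  have small: "2 ^ j * (1 / 2) ^ a \<le> \<epsilon> / 2" "C * (2 ^ j * (1 / 2) ^ a) \<le> \<epsilon>"
    using a0[OF a] C by (auto simp: \<eta>_def field_simps)
  obtain i where i: "i < j"
    "\<And>x. x \<in> X \<Longrightarrow> \<bar>\<Sum>A\<in>Pow {..<j}. rademacher i A * x (y (block_index j a A))\<bar> \<le> \<epsilon> / 2 * 2 ^ j"
    using rademacher_uncorrelated[OF X(1), of j "\<lambda>x A. blinfun_apply x (y (block_index j a A))" "\<epsilon> / 2"]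
      block j1(1) \<epsilon> by auto
  have "N (x + \<sigma> *\<^sub>R bump i j a) \<le> 1 + \<epsilon>" if "x \<in> X" "\<bar>\<sigma>\<bar> = 1" for x \<sigma>
    using X(2) block i j2 small that by (intro N_add_bump_le) auto
  from this[of _ 1] this[of _ "-1"]
  have "\<forall>x\<in>X. N (x + bump i j a) \<le> 1 + \<epsilon> \<and> N (x - bump i j a) \<le> 1 + \<epsilon>" by simp
  moreover have "1 - \<epsilon> \<le> N (bump i j a)" using N_bump_ge[OF i(1), of a] small(1) \<epsilon> by linarith
  ultimately show "\<exists>h. 1 - \<epsilon> \<le> N h \<and> (\<forall>x\<in>X. N (x + h) \<le> 1 + \<epsilon> \<and> N (x - h) \<le> 1 + \<epsilon>)"
    by blast
qed

end

section \<open>The characterization\<close>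

theorem theorem3p8:
  "(\<exists>N :: ('a::banach \<Rightarrow>\<^sub>L real) \<Rightarrow> real.
      equivalent_norm N \<and> is_dual_norm N \<and> almost_square N) \<longleftrightarrow>
   contains_copy_of_c0 TYPE('a \<Rightarrow>\<^sub>L real)"
proof
  assume "\<exists>N :: ('a \<Rightarrow>\<^sub>L real) \<Rightarrow> real. equivalent_norm N \<and> is_dual_norm N \<and> almost_square N"
  then show "contains_copy_of_c0 TYPE('a \<Rightarrow>\<^sub>L real)"
    using almost_square_imp_contains_copy_of_c0 by blast
next
  assume "contains_copy_of_c0 TYPE('a \<Rightarrow>\<^sub>L real)"
  then obtain f :: "nat \<Rightarrow> 'a \<Rightarrow>\<^sub>L real" and y C K where *: "0 < C \<and> 0 < K \<and>
      (\<forall>F x. finite F \<longrightarrow> (\<Sum>n\<in>F. \<bar>f n x\<bar>) \<le> C * norm x) \<and>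
      (\<forall>n. f n (y n) = 1 \<and> norm (y n) \<le> K) \<and> (\<forall>n m. n \<noteq> m \<longrightarrow> \<bar>f n (y m)\<bar> \<le> (1 / 2) ^ n)"
    by (elim contains_copy_of_c0_imp_almost_biorthogonal[elim_format] exE) (rule that)
  have "almost_biorthogonal f y C K"
    by unfold_locales (use * in auto)
  then interpret almost_biorthogonal f y C K .
  show "\<exists>N :: ('a \<Rightarrow>\<^sub>L real) \<Rightarrow> real. equivalent_norm N \<and> is_dual_norm N \<and> almost_square N"
    using equivalent_norm_N is_dual_norm_N almost_square_N by blast
qed

end
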